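(* Let $\Gamma$ be a forcing class. Then the forcing axiom $\mathsf{FA}(\Gamma)$ implies $\Gamma$-$\mathsf{DSRP}$.
   Context: $\mathsf{FA}(\Gamma)$: whenever $\mathbb{P}\in\Gamma$ and $\langle D_i\mid i<\omega_1\rangle$ is a sequence of dense subsets of $\mathbb{P}$, there is a filter $F\subseteq\mathbb{P}$ such that $F\cap D_i\ne\emptyset$ for all $i<\omega_1$. Let $\kappa>\omega_1$ be regular, $\mathcal{S}$ a nonempty collection of stationary subsets of $[H_\kappa]^\omega$ (where $[Y]^\omega$ is the set of countable subsets of $Y$), and $\vec{T}=\langle T_i\mid i<\omega_1\rangle$ a sequence of pairwise disjoint stationary subsets of $\omega_1$. The poset $\mathbb{P}^{\mathsf{DSRP}}_{\mathcal{S},\vec{T}}$ consists of all pairs $p=\langle\vec{Q}^p,\vec{S}^p\rangle$ such that for some $\delta^p,\lambda^p<\omega_1$: (1) $\vec{Q}^p=\langle Q^p_\alpha\mid\alpha\le\delta^p\rangle$ is a continuous $\in$-chain of elements of $[H_\kappa]^\omega$ ($Q^p_\alpha\in Q^p_{\alpha+1}$, with unions at limits); (2) $\vec{S}^p=\langle S^p_i\mid i<\lambda^p\rangle$ with each $S^p_i\in\mathcal{S}$; (3) whenever $\alpha\le\delta^p$ and $i<\omega_1$ are such that $\alpha\in T_i$, then $i<\lambda^p$ and $Q^p_\alpha\in S^p_i$. The ordering is by extension of functions in both coordinates. $\langle\mathcal{S},\vec{T}\rangle$ is $\Gamma$-projective stationary if $\mathbb{P}^{\mathsf{DSRP}}_{\mathcal{S},\vec{T}}\in\Gamma$.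 For a set $X$, $\langle\vec{Q},\vec{S}\rangle$ is a diagonal chain through $\mathcal{S}$ up to $X$ with respect to $\vec{T}$ if: (1) $\vec{Q}=\langle Q_i\mid i<\omega_1\rangle$ is a continuous $\in$-chain of countable subsets of $H_\kappa$ ($Q_i\in Q_{i+1}$, $Q_\lambda=\bigcup_{i<\lambda}Q_i$ for limit $\lambda$); (2) $\vec{S}=\langle S_i\mid i<\omega_1\rangle$ is a sequence of members of $\mathcal{S}$ such that whenever $i\in T_j$, then $Q_i\in S_j$; (3) $H_\kappa\cap X=\bigcup_{\alpha<\omega_1}Q_\alpha$ and $\langle Q_i\mid i<\alpha\rangle\in H_\kappa\cap X$ for all $\alpha<\omega_1$; (4) $\mathcal{S}\cap X=\{S_i\mid i<\omega_1\}$. $\mathsf{DSRP}(\mathcal{S},\vec{T})$ says that for a sufficiently large regular $\theta$ (so that $\mathcal{S}\subseteq H_\theta$, i.e. $\theta>2^{<\kappa}$), the set of $X\in[H_\theta]^{\omega_1}$ such that $\omega_1\subseteq X$ and there is a diagonal chain through $\mathcal{S}$ up to $X$ with respect to $\vec{T}$ is stationary in $H_\theta$ (i.e., for every $F:[H_\theta]^{<\omega}\to H_\theta$ it has a member closed under $F$). For regular $\kappa>\omega_1$, $\Gamma$-$\mathsf{DSRP}(\kappa)$ says that whenever $\mathcal{S}$ is a nonempty collection of stationary subsets of $[H_\kappa]^\omega$ and $\vec{T}=\langle T_i\mid i<\omega_1\rangle$ is a sequence of pairwise disjoint stationary subsets of $\omega_1$ such that $\langle\mathcal{S},\vec{T}\rangle$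 is $\Gamma$-projective stationary, then $\mathsf{DSRP}(\mathcal{S},\vec{T})$ holds. $\Gamma$-$\mathsf{DSRP}$ says that $\Gamma$-$\mathsf{DSRP}(\kappa)$ holds for every regular $\kappa>\omega_1$. *)

theory Defs
  imports "HOL-Library.Equipollence" "HOL-Library.Countable_Set" "HOL-Library.Disjoint_Sets"
begin

text \<open>
  The ambient universe of sets is a type whose elements satisfy the axioms of ZFC. Separation and
  Replacement range over all HOL predicates and functions, so HOL sets of elements of the universe
  play the role of classes. The axiom of choice is not listed because it follows from Hilbert
  choice and Replacement.
\<close>

class zfc_universe =
  fixes elts :: "'a \<Rightarrow> 'a set"
  assumes extensionality: "elts x = elts y \<Longrightarrow> x = y"
    and foundation: "elts x \<noteq> {} \<Longrightarrow> \<exists>y\<in>elts x. elts y \<inter> elts x = {}"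
    and pairing: "\<exists>z. elts z = {x, y}"
    and union: "\<exists>z. elts z = (\<Union>y\<in>elts x. elts y)"
    and powerset: "\<exists>z. elts z = {y. elts y \<subseteq> elts x}"
    and infinity: "\<exists>w. (\<exists>e\<in>elts w. elts e = {}) \<and>
                       (\<forall>x\<in>elts w. \<exists>y\<in>elts w. elts y = insert x (elts x))"
    and separation: "\<exists>z. elts z = {y \<in> elts x. \<phi> y}"
    and replacement: "\<exists>z. elts z = f ` elts x"

definition small :: "'v::zfc_universe set \<Rightarrow> bool" where
  "small A \<longleftrightarrow> (\<exists>x. elts x = A)"

text \<open>Only meaningful for small arguments.\<close>

definition vset :: "'v::zfc_universe set \<Rightarrow> 'v" where
  "vset A = (THE x. elts x = A)"

definition vpair :: "'v::zfc_universe \<Rightarrow> 'v \<Rightarrow> 'v" where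
  "vpair x y = vset {vset {x}, vset {x, y}}"

text \<open>The sequence \<open>\<langle>f i | i < \<alpha>\<rangle>\<close> as an element of the universe.\<close>

definition vseq :: "'v::zfc_universe \<Rightarrow> ('v \<Rightarrow> 'v) \<Rightarrow> 'v" where
  "vseq \<alpha> f = vset ((\<lambda>i. vpair i (f i)) ` elts \<alpha>)"


section \<open>Ordinals and cardinals\<close>

definition transitive :: "'v::zfc_universe \<Rightarrow> bool" where
  "transitive x \<longleftrightarrow> (\<forall>y\<in>elts x. elts y \<subseteq> elts x)"

definition Ord :: "'v::zfc_universe \<Rightarrow> bool" where
  "Ord \<alpha> \<longleftrightarrow> transitive \<alpha> \<and> (\<forall>\<beta>\<in>elts \<alpha>. transitive \<beta>)"

definition vsucc :: "'v::zfc_universe \<Rightarrow> 'v" where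
  "vsucc \<alpha> = vset (insert \<alpha> (elts \<alpha>))"

definition Limit :: "'v::zfc_universe \<Rightarrow> bool" where
  "Limit \<alpha> \<longleftrightarrow> Ord \<alpha> \<and> elts \<alpha> \<noteq> {} \<and> (\<forall>\<beta>\<in>elts \<alpha>. vsucc \<beta> \<in> elts \<alpha>)"

text \<open>
  By Replacement, HOL functions between the extensions of two sets are the same thing as
  functions in the universe, so the library's equipollence relations compare cardinalities
  as computed in the universe.
\<close>

definition Card :: "'v::zfc_universe \<Rightarrow> bool" where
  "Card \<kappa> \<longleftrightarrow> Ord \<kappa> \<and> (\<forall>\<alpha>\<in>elts \<kappa>. elts \<alpha> \<prec> elts \<kappa>)"

definition vcard :: "'v::zfc_universe \<Rightarrow> 'v" where
  "vcard x = (THE \<kappa>. Card \<kappa> \<and> elts \<kappa> \<approx> elts x)"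

definition omega1 :: "'v::zfc_universe" where
  "omega1 = vset {\<alpha>. Ord \<alpha> \<and> countable (elts \<alpha>)}"

definition regular :: "'v::zfc_universe \<Rightarrow> bool" where
  "regular \<kappa> \<longleftrightarrow> Card \<kappa> \<and> infinite (elts \<kappa>) \<and>
     (\<forall>A \<subseteq> elts \<kappa>. A \<prec> elts \<kappa> \<longrightarrow> (\<exists>\<beta>\<in>elts \<kappa>. A \<subseteq> elts \<beta>))"

definition vpow :: "'v::zfc_universe \<Rightarrow> 'v" where
  "vpow x = vset {y. elts y \<subseteq> elts x}"

text \<open>The cardinal \<open>2\<^bsup><\<kappa>\<^esup>\<close>, the supremum of all \<open>2\<^sup>\<mu>\<close> for cardinals \<open>\<mu> < \<kappa>\<close>.\<close>

definition weak_power :: "'v::zfc_universe \<Rightarrow> 'v" where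
  "weak_power \<kappa> = vset (\<Union>\<mu> \<in> {\<mu> \<in> elts \<kappa>. Card \<mu>}. elts (vcard (vpow \<mu>)))"

definition trans_closure :: "'v::zfc_universe \<Rightarrow> 'v set" where
  "trans_closure x = {y. (y, x) \<in> {(a, b). a \<in> elts b}\<^sup>+}"

definition H :: "'v::zfc_universe \<Rightarrow> 'v set" where
  "H \<kappa> = {x. trans_closure x \<prec> elts \<kappa>}"


section \<open>Stationarity\<close>

definition club_omega1 :: "'v::zfc_universe set \<Rightarrow> bool" where
  "club_omega1 C \<longleftrightarrow> C \<subseteq> elts omega1 \<and>
     (\<forall>\<alpha>\<in>elts omega1. \<exists>\<beta>\<in>C. \<alpha> \<in> elts \<beta>) \<and>
     (\<forall>\<gamma>\<in>elts omega1. Limit \<gamma> \<and> (\<forall>\<alpha>\<in>elts \<gamma>. \<exists>\<beta>\<in>C \<inter> elts \<gamma>. \<alpha> \<in> elts \<beta>) \<longrightarrow> \<gamma> \<in> C)"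

definition stationary_omega1 :: "'v::zfc_universe set \<Rightarrow> bool" where
  "stationary_omega1 T \<longleftrightarrow> T \<subseteq> elts omega1 \<and> (\<forall>C. club_omega1 C \<longrightarrow> T \<inter> C \<noteq> {})"

text \<open>A collection \<open>\<X>\<close> of subsets of \<open>A\<close> is stationary in \<open>A\<close>.\<close>

definition stationary_in :: "'v::zfc_universe set \<Rightarrow> 'v set set \<Rightarrow> bool" where
  "stationary_in A \<X> \<longleftrightarrow> (\<forall>X\<in>\<X>. X \<subseteq> A) \<and>
     (\<forall>F :: 'v set \<Rightarrow> 'v. (\<forall>x. finite x \<and> x \<subseteq> A \<longrightarrow> F x \<in> A) \<longrightarrow>
        (\<exists>X\<in>\<X>. \<forall>x. finite x \<and> x \<subseteq> X \<longrightarrow> F x \<in> X))"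

text \<open>Here \<open>S\<close> is an element of the universe whose members are countable subsets of \<open>H \<kappa>\<close>.\<close>

definition stationary_countable :: "'v::zfc_universe \<Rightarrow> 'v \<Rightarrow> bool" where
  "stationary_countable \<kappa> S \<longleftrightarrow>
     (\<forall>x\<in>elts S. elts x \<subseteq> H \<kappa> \<and> countable (elts x)) \<and>
     stationary_in (H \<kappa>) (elts ` elts S)"


section \<open>Forcing axioms\<close>

text \<open>
  A forcing notion is a small nonempty carrier with a preorder \<open>r\<close>; \<open>(q, p) \<in> r\<close> means that
  \<open>q\<close> is stronger than \<open>p\<close>. Antisymmetry is not required, so classes of partial orders are covered.
\<close>

type_synonym 'v forcing = "'v set \<times> 'v rel"

definition forcing_class :: "'v::zfc_universe forcing set \<Rightarrow> bool" where
  "forcing_class \<Gamma> \<longleftrightarrow> (\<forall>(P, r)\<in>\<Gamma>. small P \<and> P \<noteq> {} \<and> preorder_on P r)"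

definition dense_in :: "'v forcing \<Rightarrow> 'v set \<Rightarrow> bool" where
  "dense_in \<P> D \<longleftrightarrow> (case \<P> of (P, r) \<Rightarrow> D \<subseteq> P \<and> (\<forall>p\<in>P. \<exists>q\<in>D. (q, p) \<in> r))"

definition filter_on :: "'v forcing \<Rightarrow> 'v set \<Rightarrow> bool" where
  "filter_on \<P> G \<longleftrightarrow> (case \<P> of (P, r) \<Rightarrow>
     G \<subseteq> P \<and> G \<noteq> {} \<and>
     (\<forall>p\<in>G. \<forall>q\<in>P. (p, q) \<in> r \<longrightarrow> q \<in> G) \<and>
     (\<forall>p\<in>G. \<forall>q\<in>G. \<exists>s\<in>G. (s, p) \<in> r \<and> (s, q) \<in> r))"

definition FA :: "'v::zfc_universe forcing set \<Rightarrow> bool" where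
  "FA \<Gamma> \<longleftrightarrow> (\<forall>\<P>\<in>\<Gamma>. \<forall>D :: 'v \<Rightarrow> 'v set.
     (\<forall>i\<in>elts omega1. dense_in \<P> (D i)) \<longrightarrow>
     (\<exists>G. filter_on \<P> G \<and> (\<forall>i\<in>elts omega1. G \<inter> D i \<noteq> {})))"


section \<open>The diagonal strong reflection principle\<close>

text \<open>\<open>\<langle>Q i | i < \<eta>\<rangle>\<close> is a continuous \<open>\<in>\<close>-chain of countable subsets of \<open>H \<kappa>\<close>.\<close>

definition continuous_chain :: "'v::zfc_universe \<Rightarrow> 'v \<Rightarrow> ('v \<Rightarrow> 'v) \<Rightarrow> bool" where
  "continuous_chain \<kappa> \<eta> Q \<longleftrightarrow>
     (\<forall>\<alpha>\<in>elts \<eta>. elts (Q \<alpha>) \<subseteq> H \<kappa> \<and> countable (elts (Q \<alpha>))) \<and>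
     (\<forall>\<alpha>\<in>elts \<eta>. vsucc \<alpha> \<in> elts \<eta> \<longrightarrow> Q \<alpha> \<in> elts (Q (vsucc \<alpha>))) \<and>
     (\<forall>\<alpha>\<in>elts \<eta>. Limit \<alpha> \<longrightarrow> elts (Q \<alpha>) = (\<Union>\<beta>\<in>elts \<alpha>. elts (Q \<beta>)))"

definition DSRP_conditions ::
  "'v::zfc_universe \<Rightarrow> 'v set \<Rightarrow> ('v \<Rightarrow> 'v set) \<Rightarrow> 'v set" where
  "DSRP_conditions \<kappa> \<S> T =
     {vpair (vseq (vsucc \<delta>) Q) (vseq \<nu> S) | \<delta> \<nu> Q S.
        \<delta> \<in> elts omega1 \<and> \<nu> \<in> elts omega1 \<and>
        continuous_chain \<kappa> (vsucc \<delta>) Q \<and>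
        (\<forall>i\<in>elts \<nu>. S i \<in> \<S>) \<and>
        (\<forall>\<alpha>\<in>elts (vsucc \<delta>). \<forall>i\<in>elts omega1.
           \<alpha> \<in> T i \<longrightarrow> i \<in> elts \<nu> \<and> Q \<alpha> \<in> elts (S i))}"

definition DSRP_forcing ::
  "'v::zfc_universe \<Rightarrow> 'v set \<Rightarrow> ('v \<Rightarrow> 'v set) \<Rightarrow> 'v forcing" where
  "DSRP_forcing \<kappa> \<S> T =
     (DSRP_conditions \<kappa> \<S> T,
      {(vpair Q' S', vpair Q S) | Q' S' Q S.
         vpair Q' S' \<in> DSRP_conditions \<kappa> \<S> T \<and> vpair Q S \<in> DSRP_conditions \<kappa> \<S> T \<and>
         elts Q \<subseteq> elts Q' \<and> elts S \<subseteq> elts S'})"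

definition projective_stationary ::
  "'v::zfc_universe forcing set \<Rightarrow> 'v \<Rightarrow> 'v set \<Rightarrow> ('v \<Rightarrow> 'v set) \<Rightarrow> bool" where
  "projective_stationary \<Gamma> \<kappa> \<S> T \<longleftrightarrow> DSRP_forcing \<kappa> \<S> T \<in> \<Gamma>"

definition diagonal_chain ::
  "'v::zfc_universe \<Rightarrow> 'v set \<Rightarrow> ('v \<Rightarrow> 'v set) \<Rightarrow> 'v set \<Rightarrow> ('v \<Rightarrow> 'v) \<Rightarrow> ('v \<Rightarrow> 'v) \<Rightarrow> bool" where
  "diagonal_chain \<kappa> \<S> T X Q S \<longleftrightarrow>
     continuous_chain \<kappa> omega1 Q \<and>
     (\<forall>j\<in>elts omega1. S j \<in> \<S>) \<and>
     (\<forall>i\<in>elts omega1. \<forall>j\<in>elts omega1. i \<in> T j \<longrightarrow> Q i \<in> elts (S j)) \<and>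
     H \<kappa> \<inter> X = (\<Union>\<alpha>\<in>elts omega1. elts (Q \<alpha>)) \<and>
     (\<forall>\<alpha>\<in>elts omega1. vseq \<alpha> Q \<in> H \<kappa> \<inter> X) \<and>
     \<S> \<inter> X = S ` elts omega1"

text \<open>
  ``For a sufficiently large regular \<open>\<theta>\<close>'' is read as: for every regular \<open>\<theta> > 2\<^bsup><\<kappa>\<^esup>\<close>.
\<close>

definition DSRP :: "'v::zfc_universe \<Rightarrow> 'v set \<Rightarrow> ('v \<Rightarrow> 'v set) \<Rightarrow> bool" where
  "DSRP \<kappa> \<S> T \<longleftrightarrow> (\<forall>\<theta>. regular \<theta> \<and> weak_power \<kappa> \<in> elts \<theta> \<longrightarrow>
     stationary_in (H \<theta>)
       {X. X \<subseteq> H \<theta> \<and> X \<approx> elts (omega1 :: 'v) \<and> elts omega1 \<subseteq> X \<and>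
           (\<exists>Q S. diagonal_chain \<kappa> \<S> T X Q S)})"

definition class_DSRP_at :: "'v::zfc_universe forcing set \<Rightarrow> 'v \<Rightarrow> bool" where
  "class_DSRP_at \<Gamma> \<kappa> \<longleftrightarrow> (\<forall>\<S> T.
     \<S> \<noteq> {} \<and> (\<forall>S\<in>\<S>. stationary_countable \<kappa> S) \<and>
     (\<forall>i\<in>elts omega1. stationary_omega1 (T i)) \<and> disjoint_family_on T (elts omega1) \<and>
     projective_stationary \<Gamma> \<kappa> \<S> T \<longrightarrow> DSRP \<kappa> \<S> T)"

definition class_DSRP :: "'v::zfc_universe forcing set \<Rightarrow> bool" where
  "class_DSRP \<Gamma> \<longleftrightarrow> (\<forall>\<kappa>. regular \<kappa> \<and> omega1 \<in> elts \<kappa> \<longrightarrow> class_DSRP_at \<Gamma> \<kappa>)"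

end

theory Submission
  imports Defs
begin

text \<open>
  Let \<open>F\<close> be a function from finite subsets of \<open>H \<theta>\<close> to \<open>H \<theta>\<close>. A filter in the DSRP forcing whose
  chains and labels have unbounded length in \<open>omega1\<close> yields sequences \<open>Q\<close> and \<open>S\<close>. A natural candidate
  for the reflecting set is the closure under \<open>F\<close> of the union of the \<open>Q \<alpha>\<close>, the labels \<open>S i\<close>, the
  countable ordinals and the initial segments of \<open>Q\<close>. It has size \<open>omega1\<close>, but closing under \<open>F\<close>
  may produce elements of \<open>H \<kappa>\<close> outside all \<open>Q \<alpha>\<close>, or members of \<open>\<S>\<close> that are not labels.

  This is prevented by \<open>omega1\<close> many dense sets. For each \<open>\<alpha>\<close>, the part of the generators that is
  known at stage \<open>\<alpha>\<close> is countable and decided by any condition that reaches \<open>\<alpha>\<close>, hence so is its closure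
  under \<open>F\<close>. The conditions that have absorbed this closure into their chain and labels are dense
  (\<open>dense_closing_conditions\<close>). Every finite set of generators belongs to some stage, so a filter
  that meets all these dense sets gives a diagonal chain (\<open>diagonal_chain_of_filter\<close>).

  Density rests on the extension of countable chains (\<open>chain_extension_exists\<close>): a chain can be
  extended to any countable length, to cover any countable subset of \<open>H \<kappa>\<close>, with each new entry \<open>Q \<beta>\<close>
  in a prescribed stationary set \<open>R \<beta>\<close>. The limit step builds an \<open>\<omega>\<close>-sequence of chains inside a
  closure point of the stationary set prescribed for the limit. It suffices to prescribe one set at
  each \<open>\<beta>\<close> because the sets \<open>T i\<close> are disjoint.

  The rest is set theory in the given universe. Coding sets by relations on cardinals, as in
  Mostowski's theorem, yields the existence of \<open>omega1\<close> and the bound \<open>\<bar>H \<kappa>\<bar> \<le> 2\<^bsup><\<kappa>\<^esup>\<close>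
  (\<open>H_lepoll_weak_power\<close>), by which \<open>H \<kappa>\<close> and \<open>\<S>\<close> are subsets of \<open>H \<theta>\<close>. Regularity of
  \<open>\<kappa>\<close> makes \<open>H \<kappa>\<close> closed under countable subsets, hence under the codes of countable chains.
\<close>

section \<open>Small sets and membership\<close>

lemma small_elts: "small (elts x)"
  unfolding small_def by blast

lemma vset_elts: "vset (elts x) = x"
  unfolding vset_def by (rule the_equality) (auto intro: extensionality)

lemma elts_vset: "small A \<Longrightarrow> elts (vset A) = A"
  unfolding small_def using vset_elts by metis

lemma small_subset:
  assumes "small A" "B \<subseteq> A" shows "small B"
proof -
  obtain x where "elts x = A" using assms unfolding small_def by blast
  then have "B = {y \<in> elts x. y \<in> B}" using assms by blast
  then show ?thesis using separation[of x "\<lambda>y. y \<in> B"] unfolding small_def by metis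
qed

lemma small_image: "small A \<Longrightarrow> small ((f :: 'v::zfc_universe \<Rightarrow> 'v) ` A)"
  unfolding small_def using replacement[of f] by blast

lemma small_UN:
  fixes B :: "'v::zfc_universe \<Rightarrow> 'v set"
  assumes "small A" "\<And>a. a \<in> A \<Longrightarrow> small (B a)"
  shows "small (\<Union>a\<in>A. B a)"
proof -
  have "small ((\<lambda>a. vset (B a)) ` A)" using assms(1) by (rule small_image)
  then obtain y where y: "elts y = (\<lambda>a. vset (B a)) ` A" unfolding small_def by blast
  obtain z where z: "elts z = (\<Union>u\<in>elts y. elts u)" using union[of y] by (rule exE)
  have "(\<Union>u\<in>elts y. elts u) = (\<Union>a\<in>A. B a)"
    unfolding y UN_simps(10) by (rule SUP_cong[OF refl elts_vset[OF assms(2)]])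
  then show ?thesis using small_elts[of z] by (simp only: z)
qed

lemma small_pair: "small {x, y}"
  unfolding small_def by (rule pairing)

lemma small_Un: "small A \<Longrightarrow> small B \<Longrightarrow> small (A \<union> B :: 'v::zfc_universe set)"
proof -
  assume "small A" "small B"
  then obtain a b where ab: "elts a = A" "elts b = B" unfolding small_def by blast
  have "small (\<Union>u\<in>{a,b}. elts u)" by (rule small_UN[OF small_pair small_elts])
  then show ?thesis using ab by simp
qed

lemma small_empty: "small {}"
  by (rule small_subset[OF small_elts empty_subsetI])

lemma small_insert: "small A \<Longrightarrow> small (insert a A)"
  using small_Un[OF small_pair[of a a]] by simp

lemma small_lepoll:
  fixes B :: "'v::zfc_universe set"
  assumes "A \<lesssim> B" "small B" shows "small (A :: 'v set)"
proof -
  obtain f where f: "inj_on f A" "f ` A \<subseteq> B" using assms(1) unfolding lepoll_def by blast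
  have "A = inv_into A f ` (f ` A)" using f by (simp add: inv_into_image_cancel)
  then show ?thesis using small_image[OF small_subset[OF assms(2) f(2)], of "inv_into A f"] by simp
qed

lemma small_bounded_subsets: "small {y. elts y \<subseteq> elts x}"
  unfolding small_def by (rule powerset)

lemma elts_vpow: "elts (vpow x) = {y. elts y \<subseteq> elts x}"
  unfolding vpow_def by (rule elts_vset[OF small_bounded_subsets])

lemma elts_vpow_eqpoll: "elts (vpow x) \<approx> Pow (elts x)"
proof -
  have "bij_betw elts (elts (vpow x)) (Pow (elts x))"
    unfolding elts_vpow bij_betw_def
  proof
    show "inj_on elts {y. elts y \<subseteq> elts x}" by (auto intro: inj_onI extensionality)
    have "B \<in> elts ` {y. elts y \<subseteq> elts x}" if "B \<subseteq> elts x" for B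
      using elts_vset[OF small_subset[OF small_elts that]] that by (metis image_eqI mem_Collect_eq)
    then show "elts ` {y. elts y \<subseteq> elts x} = Pow (elts x)" by blast
  qed
  then show ?thesis unfolding eqpoll_def by blast
qed

lemma mem_irrefl: "x \<notin> elts x"
proof
  assume *: "x \<in> elts x"
  have "elts (vset {x}) = {x}" using elts_vset[OF small_pair[of x x]] by simp
  then show False using foundation[of "vset {x}"] * by auto
qed

lemma mem_asym: "x \<in> elts y \<Longrightarrow> y \<notin> elts x"
  using foundation[of "vset {x, y}"] elts_vset[OF small_pair[of x y]] by auto

lemma nat_embeds_small: "\<exists>f :: nat \<Rightarrow> 'v::zfc_universe. inj f \<and> small (range f)"
proof -
  obtain w e where e: "e \<in> elts w" and w: "\<forall>x\<in>elts w. \<exists>y\<in>elts w. elts y = insert x (elts (x::'v))"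
    using infinity by blast
  have "\<exists>f. \<forall>n. f n \<in> elts w \<and> elts (f (Suc n)) = insert (f n) (elts (f n))"
    using w e by (intro dependent_nat_choice) auto
  then obtain f where f: "\<And>n. f n \<in> elts w" "\<And>n. elts (f (Suc n)) = insert (f n) (elts (f n))"
    by blast
  have less: "f m \<in> elts (f n)" if "m < n" for m n
    using that by (induction n) (auto simp: f(2) less_Suc_eq)
  have "inj f"
  proof (rule injI)
    fix m n assume "f m = f n"
    then show "m = n" using less[of m n] less[of n m] mem_irrefl[of "f m"]
      by (cases m n rule: linorder_cases) auto
  qed
  then show ?thesis using f(1) small_subset[OF small_elts, of "range f" w] by blast
qed

lemma small_countable:
  assumes "countable (A :: 'v::zfc_universe set)" shows "small A"
proof -
  obtain f :: "nat \<Rightarrow> 'v" where f: "inj f" "small (range f)" using nat_embeds_small by blast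
  have "A \<lesssim> (UNIV::nat set)" using assms unfolding countable_def lepoll_def by blast
  also have "\<dots> \<lesssim> range f" unfolding lepoll_def using f by blast
  finally show ?thesis using f(2) small_lepoll by blast
qed

lemmas elts_vset_countable = elts_vset[OF small_countable]

lemma elts_subset_trans_closure: "elts x \<subseteq> trans_closure x"
  unfolding trans_closure_def by auto

lemma trans_closure_mono: "y \<in> trans_closure x \<Longrightarrow> trans_closure y \<subseteq> trans_closure x"
  unfolding trans_closure_def by (auto intro: trancl_trans)

lemma trans_closure_least:
  assumes "elts x \<subseteq> B" "\<And>y. y \<in> B \<Longrightarrow> elts y \<subseteq> B"
  shows "trans_closure x \<subseteq> B"
proof
  fix y assume "y \<in> trans_closure x"
  then have "(y, x) \<in> {(a, b). a \<in> elts b}\<^sup>+" by (simp add: trans_closure_def)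
  then show "y \<in> B" by (induction rule: converse_trancl_induct) (use assms in auto)
qed

lemma small_trans_closure: "small (trans_closure (x :: 'v::zfc_universe))"
proof -
  define U where "U n = ((\<lambda>A. \<Union>y\<in>A. elts y) ^^ n) (elts x)" for n :: nat
  have U0: "U 0 = elts x" and US: "U (Suc n) = (\<Union>y\<in>U n. elts y)" for n
    by (simp_all add: U_def)
  have sm: "small (U n)" for n
    by (induction n) (auto simp: U0 US intro: small_elts small_UN)
  obtain f :: "nat \<Rightarrow> 'v" where f: "inj f" "small (range f)" using nat_embeds_small by blast
  have "small (\<Union>a\<in>range f. U (inv f a))" by (rule small_UN[OF f(2) sm])
  moreover have "trans_closure x \<subseteq> (\<Union>a\<in>range f. U (inv f a))"
  proof (rule trans_closure_least)
    have eq: "(\<Union>a\<in>range f. U (inv f a)) = (\<Union>n. U n)" using f(1) by simp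
    show "elts x \<subseteq> (\<Union>a\<in>range f. U (inv f a))" unfolding eq using U0 by blast
    show "elts y \<subseteq> (\<Union>a\<in>range f. U (inv f a))" if "y \<in> (\<Union>a\<in>range f. U (inv f a))" for y
      using that US unfolding eq by blast
  qed
  ultimately show ?thesis by (rule small_subset)
qed

text \<open>Foundation speaks of sets; smallness of the transitive closure extends it to classes.\<close>

lemma wf_mem: "wf {(a, b :: 'v::zfc_universe). a \<in> elts b}"
proof (rule wfI_min)
  fix x and A :: "'v set" assume x: "x \<in> A"
  define B where "B = insert x (trans_closure x) \<inter> A"
  have "small B" unfolding B_def
    by (rule small_subset[OF small_insert[OF small_trans_closure]]) blast
  then have "elts (vset B) = B" by (rule elts_vset)
  moreover have "x \<in> B" using x by (simp add: B_def)
  ultimately obtain y where y: "y \<in> B" "elts y \<inter> B = {}" using foundation[of "vset B"] by auto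
  have "elts y \<subseteq> trans_closure x"
    using y(1) elts_subset_trans_closure[of y] elts_subset_trans_closure[of x] trans_closure_mono
    unfolding B_def by blast
  then show "\<exists>z\<in>A. \<forall>y. (y, z) \<in> {(a, b). a \<in> elts b} \<longrightarrow> y \<notin> A"
    using y unfolding B_def by blast
qed

lemma mem_induct [case_names mem]:
  assumes "\<And>x. (\<And>y. y \<in> elts x \<Longrightarrow> P y) \<Longrightarrow> P x" shows "P (x :: 'v::zfc_universe)"
  using wf_induct_rule[OF wf_mem, of P x] assms by blast

section \<open>Pairs and sequences\<close>

lemma elts_vset_pair [simp]: "elts (vset {x, y}) = {x, y}"
  by (rule elts_vset[OF small_pair])

lemma elts_vset_singleton [simp]: "elts (vset {x}) = {x}"
  using elts_vset_pair[of x x] by simp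

lemma vset_pair_eq_iff: "vset {a, b} = vset {c, d} \<longleftrightarrow> {a, b} = {c, d}"
  by (metis elts_vset_pair)

lemma vpair_inject [simp]: "vpair x y = vpair x' y' \<longleftrightarrow> x = x' \<and> y = y'"
proof
  have *: "vpair a b = vset {vset {a, a}, vset {a, b}}" for a b :: 'a by (simp add: vpair_def)
  assume "vpair x y = vpair x' y'"
  then have "{vset {x, x}, vset {x, y}} = {vset {x', x'}, vset {x', y'}}"
    by (simp only: * vset_pair_eq_iff)
  then have "({x, x} = {x', x'} \<and> {x, y} = {x', y'}) \<or> ({x, x} = {x', y'} \<and> {x, y} = {x', x'})"
    by (simp only: doubleton_eq_iff vset_pair_eq_iff)
  then show "x = x' \<and> y = y'" by (elim disjE conjE) (auto simp: doubleton_eq_iff)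
qed simp

lemma elts_vseq: "elts (vseq \<alpha> f) = (\<lambda>i. vpair i (f i)) ` elts \<alpha>"
  unfolding vseq_def by (rule elts_vset[OF small_image[OF small_elts]])

lemma vseq_subset_iff:
  "elts (vseq \<alpha> f) \<subseteq> elts (vseq \<beta> g) \<longleftrightarrow> elts \<alpha> \<subseteq> elts \<beta> \<and> (\<forall>i\<in>elts \<alpha>. f i = g i)"
  unfolding elts_vseq by auto

lemma vseq_eq_iff: "vseq \<alpha> f = vseq \<beta> g \<longleftrightarrow> \<alpha> = \<beta> \<and> (\<forall>i\<in>elts \<alpha>. f i = g i)"
proof
  assume "vseq \<alpha> f = vseq \<beta> g"
  then show "\<alpha> = \<beta> \<and> (\<forall>i\<in>elts \<alpha>. f i = g i)"
    using vseq_subset_iff[of \<alpha> f \<beta> g] vseq_subset_iff[of \<beta> g \<alpha> f]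
    by (auto intro!: extensionality)
next
  assume "\<alpha> = \<beta> \<and> (\<forall>i\<in>elts \<alpha>. f i = g i)"
  then show "vseq \<alpha> f = vseq \<beta> g" unfolding vseq_def by (auto intro!: arg_cong[of _ _ vset])
qed

section \<open>Ordinals\<close>

lemma elts_vsucc [simp]: "elts (vsucc \<alpha>) = insert \<alpha> (elts \<alpha>)"
  unfolding vsucc_def by (rule elts_vset[OF small_insert[OF small_elts]])

lemma Ord_elem: "Ord \<alpha> \<Longrightarrow> \<beta> \<in> elts \<alpha> \<Longrightarrow> Ord \<beta>"
  unfolding Ord_def transitive_def by blast

lemma Ord_trans: "Ord \<alpha> \<Longrightarrow> \<beta> \<in> elts \<alpha> \<Longrightarrow> \<gamma> \<in> elts \<beta> \<Longrightarrow> \<gamma> \<in> elts \<alpha>"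
  unfolding Ord_def transitive_def by blast

lemma Ord_vsucc: "Ord \<alpha> \<Longrightarrow> Ord (vsucc \<alpha>)"
  unfolding Ord_def transitive_def by auto

lemma Ord_vset: 
  assumes "small A" "\<And>\<alpha>. \<alpha> \<in> A \<Longrightarrow> Ord \<alpha> \<and> elts \<alpha> \<subseteq> A" 
  shows "Ord (vset A)"
  using assms unfolding Ord_def by (auto simp: elts_vset transitive_def)

lemma Ord_linear:
  assumes "Ord \<alpha>" "Ord \<beta>"
  shows "\<alpha> \<in> elts \<beta> \<or> \<alpha> = \<beta> \<or> \<beta> \<in> elts \<alpha>"
  using assms
proof (induction \<alpha> arbitrary: \<beta> rule: mem_induct)
  case (mem \<alpha>)
  note IH\<alpha> = mem
  from mem.prems(2) show ?case
  proof (induction \<beta> rule: mem_induct)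
    case (mem \<beta>)
    show ?case
    proof (rule ccontr)
      assume n: "\<not> ?case"
      have "elts \<alpha> \<subseteq> elts \<beta>"
        using IH\<alpha>(1)[OF _ Ord_elem[OF IH\<alpha>(2)] mem.prems] n Ord_trans[OF IH\<alpha>(2)] by blast
      moreover have "elts \<beta> \<subseteq> elts \<alpha>"
        using mem.IH[OF _ Ord_elem[OF mem.prems]] n Ord_trans[OF mem.prems] by blast
      ultimately show False using n extensionality by blast
    qed
  qed
qed

lemma Ord_cases:
  assumes "Ord \<alpha>"
  obtains "elts \<alpha> = {}" | \<beta> where "\<alpha> = vsucc \<beta>" | "Limit \<alpha>"
proof (cases "elts \<alpha> = {} \<or> Limit \<alpha>")
  case False
  then obtain \<beta> where b: "\<beta> \<in> elts \<alpha>" "vsucc \<beta> \<notin> elts \<alpha>" using assms unfolding Limit_def by blast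
  then have "\<alpha> = vsucc \<beta> \<or> \<alpha> \<in> elts (vsucc \<beta>)"
    using Ord_linear[OF assms Ord_vsucc[OF Ord_elem[OF assms b(1)]]] by blast
  then have "\<alpha> = vsucc \<beta>" using b(1) mem_irrefl mem_asym by auto
  then show ?thesis using that by blast
qed (use that in blast)

lemma Limit_not_vsucc: "\<not> Limit (vsucc \<beta>)"
  unfolding Limit_def using mem_irrefl by (metis elts_vsucc insertI1)

lemma vsucc_inject [simp]: "vsucc \<alpha> = vsucc \<beta> \<longleftrightarrow> \<alpha> = \<beta>"
  by (metis elts_vsucc insertE insertI1 mem_asym)

section \<open>Cardinality\<close>

lemma lepoll_iff_ordLeq: "A \<lesssim> B \<longleftrightarrow> (card_of A, card_of B) \<in> ordLeq"
  unfolding lepoll_def card_of_ordLeq[symmetric] by blast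

lemma not_lepoll_imp_lesspoll:
  assumes "\<not> A \<lesssim> B" shows "B \<prec> A"
proof -
  have "B \<lesssim> A"
    using assms ordLeq_total[OF card_of_Well_order card_of_Well_order] unfolding lepoll_iff_ordLeq by blast
  then show ?thesis using assms lepoll_iff_leqpoll eqpoll_sym eqpoll_imp_lepoll by blast
qed

lemma UN_lepoll:
  assumes "infinite B" "I \<lesssim> B" "\<And>i. i \<in> I \<Longrightarrow> A i \<lesssim> B"
  shows "(\<Union>i\<in>I. A i) \<lesssim> B"
  using card_of_UNION_ordLeq_infinite[of B I A] assms unfolding lepoll_iff_ordLeq by blast

lemma infinite_times_self_lepoll: "infinite A \<Longrightarrow> A \<times> A \<lesssim> A"
  using card_of_Times_same_infinite[of A] unfolding lepoll_iff_ordLeq by (rule ordIso_imp_ordLeq)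

lemma Pow_lepoll_mono:
  assumes "A \<lesssim> B" shows "Pow A \<lesssim> Pow B"
proof -
  obtain f where f: "inj_on f A" "f ` A \<subseteq> B" using assms unfolding lepoll_def by blast
  then have "inj_on ((`) f) (Pow A)" "(`) f ` Pow A \<subseteq> Pow B"
    by (auto intro: inj_on_image_Pow)
  then show ?thesis unfolding lepoll_def by blast
qed

lemma codes_lepoll_Pow:
  assumes "infinite K" shows "Pow (K \<times> K) \<times> K \<lesssim> Pow K"
proof -
  have "Pow (K \<times> K) \<times> K \<lesssim> Pow K \<times> Pow K"
    by (intro times_lepoll_mono Pow_lepoll_mono infinite_times_self_lepoll assms lepoll_Pow_self)
  also have "\<dots> \<lesssim> Pow K" using assms by (intro infinite_times_self_lepoll) (simp add: finite_Pow_iff)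
  finally show ?thesis .
qed

text \<open>
  An injection of the transitive closure of \<open>x\<close>, together with \<open>x\<close> itself, into \<open>K\<close> transports
  membership to a relation on \<open>K\<close> with a distinguished point. As in Mostowski's theorem, the relation
  and the point determine \<open>x\<close>.
\<close>

lemma hereditary_lepoll_codes:
  "{x :: 'v::zfc_universe. insert x (trans_closure x) \<lesssim> K} \<lesssim> Pow (K \<times> K) \<times> K"
proof -
  let ?C = "{x :: 'v. insert x (trans_closure x) \<lesssim> K}"
  define T where "T = (\<lambda>x :: 'v. insert x (trans_closure x))"
  have "\<forall>x\<in>?C. \<exists>j. inj_on j (T x) \<and> j ` T x \<subseteq> K" unfolding lepoll_def T_def by blast
  then obtain j where j: "\<And>x. x \<in> ?C \<Longrightarrow> inj_on (j x) (T x)" "\<And>x. x \<in> ?C \<Longrightarrow> j x ` T x \<subseteq> K"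
    by metis
  define R where "R x = {(j x a, j x b) | a b. b \<in> T x \<and> a \<in> elts b}" for x
  have T: "a \<in> T x" if "a \<in> elts b" "b \<in> T x" for a b x
    using that elts_subset_trans_closure trans_closure_mono unfolding T_def by blast
  have "inj_on (\<lambda>x. (R x, j x x)) ?C"
  proof (rule inj_onI)
    fix x y assume x: "x \<in> ?C" and y: "y \<in> ?C" and eq: "(R x, j x x) = (R y, j y y)"
    have "a \<in> T x \<longrightarrow> (\<forall>b\<in>T y. j x a = j y b \<longrightarrow> a = b)" for a
    proof (induction a rule: mem_induct)
      case (mem a)
      show ?case
      proof (intro impI ballI)
        fix b assume a: "a \<in> T x" and b: "b \<in> T y" and ab: "j x a = j y b"
        have "c \<in> elts b" if c: "c \<in> elts a" for c
        proof -
          have "(j x c, j x a) \<in> R x" using c a unfolding R_def by blast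
          then have "(j x c, j x a) \<in> R y" using eq by simp
          then obtain d e where de: "j x c = j y d" "j x a = j y e" "e \<in> T y" "d \<in> elts e"
            unfolding R_def by blast
          then have "e = b" using ab j(1)[OF y] b by (metis inj_onD)
          then show ?thesis using mem[OF c] T[OF c a] T[OF de(4,3)] de by auto
        qed
        moreover have "c \<in> elts a" if c: "c \<in> elts b" for c
        proof -
          have "(j y c, j y b) \<in> R y" using c b unfolding R_def by blast
          then have "(j y c, j y b) \<in> R x" using eq by simp
          then obtain d e where de: "j y c = j x d" "j y b = j x e" "e \<in> T x" "d \<in> elts e"
            unfolding R_def by blast
          then have "e = a" using ab j(1)[OF x] a by (metis inj_onD)
          then have "d = c" using mem[of d] de T[OF de(4,3)] T[OF c b] by auto
          then show ?thesis using de \<open>e = a\<close> by simp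
        qed
        ultimately show "a = b" by (intro extensionality) blast
      qed
    qed
    then show "x = y" using eq unfolding T_def by blast
  qed
  moreover have "(\<lambda>x. (R x, j x x)) ` ?C \<subseteq> Pow (K \<times> K) \<times> K"
    using j(2) T unfolding R_def T_def by blast
  ultimately show ?thesis unfolding lepoll_def by blast
qed

lemma Ord_trans_closure: "Ord \<alpha> \<Longrightarrow> trans_closure \<alpha> \<subseteq> elts \<alpha>"
  by (rule trans_closure_least) (auto dest: Ord_trans)

section \<open>The first uncountable ordinal\<close>

text \<open>
  Countable ordinals are hereditarily countable, so the coding embeds them into the power set of a
  countable set. This makes \<open>omega1\<close> a genuine set.
\<close>

lemma small_countable_ordinals: "small {\<alpha> :: 'v::zfc_universe. Ord \<alpha> \<and> countable (elts \<alpha>)}"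
proof -
  obtain f :: "nat \<Rightarrow> 'v" where f: "inj f" "small (range f)" using nat_embeds_small by blast
  have r: "elts (vset (range f)) = range f" by (rule elts_vset[OF f(2)])
  have "{\<alpha> :: 'v. Ord \<alpha> \<and> countable (elts \<alpha>)}
      \<subseteq> {x. insert x (trans_closure x) \<lesssim> (UNIV :: nat set)}"
  proof clarify
    fix \<alpha> :: 'v assume "Ord \<alpha>" "countable (elts \<alpha>)"
    then have "countable (insert \<alpha> (trans_closure \<alpha>))"
      using Ord_trans_closure countable_subset by blast
    then show "insert \<alpha> (trans_closure \<alpha>) \<lesssim> (UNIV :: nat set)" 
      unfolding countable_def lepoll_def by blast
  qed
  then have "{\<alpha> :: 'v. Ord \<alpha> \<and> countable (elts \<alpha>)}
      \<lesssim> {x :: 'v. insert x (trans_closure x) \<lesssim> (UNIV :: nat set)}"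
    by (rule subset_imp_lepoll)
  also have "\<dots> \<lesssim> Pow ((UNIV :: nat set) \<times> (UNIV :: nat set)) \<times> (UNIV :: nat set)"
    by (rule hereditary_lepoll_codes)
  also have "\<dots> \<lesssim> Pow (UNIV :: nat set)" by (rule codes_lepoll_Pow) simp
  also have "\<dots> \<lesssim> Pow (range f)"
    by (rule Pow_lepoll_mono) (use f(1) lepoll_def in blast)
  also have "\<dots> \<approx> elts (vpow (vset (range f)))"
    using elts_vpow_eqpoll[of "vset (range f)"] r eqpoll_sym by metis
  finally show ?thesis using small_elts small_lepoll by blast
qed

lemma elts_omega1: "elts omega1 = {\<alpha>. Ord \<alpha> \<and> countable (elts \<alpha>)}"
  unfolding omega1_def by (rule elts_vset[OF small_countable_ordinals])

lemma omega1_Ord: "\<alpha> \<in> elts omega1 \<Longrightarrow> Ord \<alpha>"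
  and omega1_countable: "\<alpha> \<in> elts omega1 \<Longrightarrow> countable (elts \<alpha>)"
  by (simp_all add: elts_omega1)

lemma omega1_trans: "\<alpha> \<in> elts omega1 \<Longrightarrow> \<beta> \<in> elts \<alpha> \<Longrightarrow> \<beta> \<in> elts omega1"
  unfolding elts_omega1 using Ord_elem Ord_trans by (blast intro: countable_subset)

lemma omega1_vsucc: "\<alpha> \<in> elts omega1 \<Longrightarrow> vsucc \<alpha> \<in> elts omega1"
  unfolding elts_omega1 by (auto intro: Ord_vsucc)

lemma Ord_omega1: "Ord omega1"
proof -
  have "Ord (vset (elts omega1))"
    by (rule Ord_vset[OF small_elts]) (use omega1_Ord omega1_trans in blast)
  then show ?thesis by (simp add: vset_elts)
qed

lemma uncountable_omega1: "uncountable (elts (omega1 :: 'v::zfc_universe))"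
  using Ord_omega1 mem_irrefl[of "omega1 :: 'v"] by (auto simp: elts_omega1)

lemma countable_bounded_omega1:
  assumes "countable A" "A \<subseteq> elts omega1"
  shows "\<exists>\<rho>\<in>elts omega1. A \<subseteq> elts \<rho>"
proof -
  define B where "B = (\<Union>\<alpha>\<in>A. elts (vsucc \<alpha>))"
  have B: "countable B" unfolding B_def
    using assms omega1_countable by (auto intro!: countable_UN)
  have "Ord (vset B)"
  proof (rule Ord_vset[OF small_countable[OF B]])
    fix \<beta> assume "\<beta> \<in> B"
    then obtain \<alpha> where a: "\<alpha> \<in> A" "\<beta> \<in> elts (vsucc \<alpha>)" unfolding B_def by blast
    then have "Ord (vsucc \<alpha>)" using assms omega1_vsucc omega1_Ord by blast
    then show "Ord \<beta> \<and> elts \<beta> \<subseteq> B" using a Ord_elem Ord_trans unfolding B_def by blast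
  qed
  then have "vset B \<in> elts omega1" using B by (simp add: elts_omega1 elts_vset_countable)
  moreover have "A \<subseteq> elts (vset B)" using B by (auto simp: elts_vset_countable B_def)
  ultimately show ?thesis by blast
qed

section \<open>Cardinals\<close>

text \<open>
  The Mostowski collapse of a well-order of \<open>A\<close> is an injection of \<open>A\<close> onto an ordinal.
\<close>

lemma ordinal_enumeration:
  assumes "small (A :: 'v::zfc_universe set)"
  shows "\<exists>\<alpha> :: 'v. Ord \<alpha> \<and> elts \<alpha> \<approx> A"
proof -
  obtain r where r: "well_order_on A r" using well_order_on by blast
  define R where "R = r - Id"
  have wf: "wf R" using r unfolding R_def well_order_on_def by blast
  have R_field: "x \<in> A \<and> y \<in> A" if "(x, y) \<in> R" for x y
    using that r unfolding R_def well_order_on_def linear_order_on_def partial_order_on_def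
      preorder_on_def refl_on_def by blast
  have R_total: "(x, y) \<in> R \<or> (y, x) \<in> R" if "x \<in> A" "y \<in> A" "x \<noteq> y" for x y
    using that r unfolding R_def well_order_on_def linear_order_on_def total_on_def by blast
  have R_trans: "(x, z) \<in> R" if "(x, y) \<in> R" "(y, z) \<in> R" for x y z
  proof -
    have t: "trans r" "antisym r" 
      using r unfolding well_order_on_def linear_order_on_def partial_order_on_def preorder_on_def by auto
    then have "(x, z) \<in> r" using that unfolding R_def by (blast dest: transD)
    moreover have "x \<noteq> z" using t that unfolding R_def by (auto dest: antisymD)
    ultimately show ?thesis unfolding R_def by simp
  qed
  define f :: "'v \<Rightarrow> 'v" where "f = wfrec R (\<lambda>f a. vset (f ` {b. (b, a) \<in> R}))"
  have "f a = vset (f ` {b. (b, a) \<in> R})" for a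
  proof -
    have "f a = vset (cut f R a ` {b. (b, a) \<in> R})" unfolding f_def by (rule wfrec[OF wf])
    also have "cut f R a ` {b. (b, a) \<in> R} = f ` {b. (b, a) \<in> R}"
      by (intro image_cong refl) (simp add: cut_def)
    finally show ?thesis .
  qed
  moreover have "small (f ` {b. (b, a) \<in> R})" for a
    by (rule small_image[OF small_subset[OF assms]]) (use R_field in blast)
  ultimately have f: "elts (f a) = f ` {b. (b, a) \<in> R}" for a using elts_vset by metis
  have tr: "transitive (f a)" for a
    unfolding transitive_def using R_trans by (fastforce simp: f)
  have "Ord (vset (f ` A))"
  proof (rule Ord_vset[OF small_image[OF assms]])
    fix \<alpha> assume "\<alpha> \<in> f ` A"
    then obtain a where a: "\<alpha> = f a" by blast
    have "Ord \<alpha>" unfolding Ord_def a f[of a] using tr by blast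
    then show "Ord \<alpha> \<and> elts \<alpha> \<subseteq> f ` A" unfolding a f[of a] using R_field by blast
  qed
  moreover have "inj_on f A"
  proof (rule inj_onI, rule ccontr)
    fix x y assume *: "x \<in> A" "y \<in> A" "f x = f y" "x \<noteq> y"
    then have "f x \<in> elts (f y) \<or> f y \<in> elts (f x)" using R_total f by blast
    then show False using * mem_irrefl by metis
  qed
  then have "elts (vset (f ` A)) \<approx> A"
    unfolding elts_vset[OF small_image[OF assms, of f]] by (rule inj_on_image_eqpoll_self)
  ultimately show ?thesis by blast
qed

lemma Card_eqI:
  assumes "Card \<kappa>" "Card \<mu>" "elts \<kappa> \<approx> elts \<mu>" shows "\<kappa> = \<mu>"
proof -
  have "\<kappa> \<notin> elts \<mu>" "\<mu> \<notin> elts \<kappa>"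
    using assms(1,2) assms(3) eqpoll_sym[OF assms(3)] unfolding Card_def lesspoll_def by blast+
  moreover have "Ord \<kappa>" "Ord \<mu>" using assms(1,2) unfolding Card_def by blast+
  ultimately show ?thesis using Ord_linear by blast
qed

text \<open>
  The least ordinal equipollent to \<open>x\<close> is a cardinal, so the description in \<^const>\<open>vcard\<close> denotes.
\<close>

lemma Card_vcard_eqpoll: "Card (vcard (x :: 'v::zfc_universe)) \<and> elts (vcard x) \<approx> elts x"
proof -
  let ?P = "\<lambda>\<alpha> :: 'v. Ord \<alpha> \<and> elts \<alpha> \<approx> elts x"
  obtain \<alpha> where "?P \<alpha>" using ordinal_enumeration[OF small_elts[of x]] by (rule exE)
  then have "\<exists>\<alpha>. ?P \<alpha> \<and> (\<forall>\<beta>\<in>elts \<alpha>. \<not> ?P \<beta>)"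
  proof (induction \<alpha> rule: mem_induct)
    case (mem \<alpha>) then show ?case by blast
  qed
  then obtain \<alpha> where a: "?P \<alpha>" and min: "\<And>\<beta>. \<beta> \<in> elts \<alpha> \<Longrightarrow> \<not> ?P \<beta>" by blast
  have "Card \<alpha>" unfolding Card_def
  proof (intro conjI ballI)
    fix \<beta> assume b: "\<beta> \<in> elts \<alpha>"
    have "elts \<beta> \<lesssim> elts \<alpha>" using b a Ord_trans by (blast intro: subset_imp_lepoll)
    moreover have "\<not> elts \<beta> \<approx> elts \<alpha>" using min[OF b] Ord_elem[of \<alpha> \<beta>] a b eqpoll_trans by blast
    ultimately show "elts \<beta> \<prec> elts \<alpha>" by (simp add: lesspoll_def)
  qed (use a in simp)
  then have "Card \<alpha> \<and> elts \<alpha> \<approx> elts x" using a by blast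
  then show ?thesis unfolding vcard_def
    by (rule theI) (use Card_eqI eqpoll_trans[OF _ eqpoll_sym] \<open>Card \<alpha> \<and> elts \<alpha> \<approx> elts x\<close> in blast)
qed

lemma Card_lesspoll_imp_mem:
  assumes "Card \<mu>" "Card \<kappa>" "elts \<mu> \<prec> elts \<kappa>" shows "\<mu> \<in> elts \<kappa>"
proof -
  have "\<kappa> \<notin> elts \<mu>" "\<kappa> \<noteq> \<mu>"
    using assms lesspoll_trans[OF assms(3)] unfolding Card_def by blast+
  moreover have "Ord \<kappa>" "Ord \<mu>" using assms(1,2) unfolding Card_def by blast+
  ultimately show ?thesis using Ord_linear by blast
qed

section \<open>The sets \<open>H \<kappa>\<close>\<close>

definition uncountable_regular :: "'v::zfc_universe \<Rightarrow> bool" where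
  "uncountable_regular \<kappa> \<longleftrightarrow> regular \<kappa> \<and> omega1 \<in> elts \<kappa>"

lemma subset_lesspoll: "A \<subseteq> B \<Longrightarrow> B \<prec> C \<Longrightarrow> A \<prec> C"
  by (rule lesspoll_trans1[OF subset_imp_lepoll])

lemma countable_lesspoll_regular:
  assumes "uncountable_regular \<kappa>" "countable A" shows "A \<prec> elts \<kappa>"
proof -
  have "\<not> elts (omega1 :: 'a) \<lesssim> A"
    using assms(2) uncountable_omega1 countable_lepoll by blast
  then have "A \<prec> elts (omega1 :: 'a)" by (rule not_lepoll_imp_lesspoll)
  also have "\<dots> \<prec> elts \<kappa>" using assms(1) unfolding uncountable_regular_def regular_def Card_def by blast
  finally show ?thesis .
qed

text \<open>
  A surjection of the union onto \<open>\<kappa>\<close> would write \<open>\<kappa>\<close> as a union of countably many subsets that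
  are bounded by regularity. The countably many bounds would have a common bound \<open>\<beta> < \<kappa>\<close>, which
  would have to lie below one of them.
\<close>

lemma countable_UN_lesspoll_regular:
  assumes \<kappa>: "uncountable_regular \<kappa>" and I: "countable I"
    and A: "\<And>i. i \<in> I \<Longrightarrow> A i \<prec> elts \<kappa>"
  shows "(\<Union>i\<in>I. A i) \<prec> elts \<kappa>"
proof (rule ccontr)
  have reg: "\<exists>\<beta>\<in>elts \<kappa>. B \<subseteq> elts \<beta>" if "B \<subseteq> elts \<kappa>" "B \<prec> elts \<kappa>" for B
    using that \<kappa> unfolding uncountable_regular_def regular_def by blast
  assume "\<not> (\<Union>i\<in>I. A i) \<prec> elts \<kappa>"
  then have "elts \<kappa> \<lesssim> (\<Union>i\<in>I. A i)" using not_lepoll_imp_lesspoll by blast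
  then obtain g where g: "elts \<kappa> \<subseteq> g ` (\<Union>i\<in>I. A i)" unfolding lepoll_iff by (rule exE)
  have "\<exists>\<beta>\<in>elts \<kappa>. g ` A i \<inter> elts \<kappa> \<subseteq> elts \<beta>" if "i \<in> I" for i
  proof (rule reg)
    have "g ` A i \<inter> elts \<kappa> \<lesssim> A i" by (rule subset_image_lepoll) blast
    then show "g ` A i \<inter> elts \<kappa> \<prec> elts \<kappa>" using A[OF that] by (rule lesspoll_trans1)
  qed blast
  then obtain b where b: "\<And>i. i \<in> I \<Longrightarrow> b i \<in> elts \<kappa>"
    "\<And>i. i \<in> I \<Longrightarrow> g ` A i \<inter> elts \<kappa> \<subseteq> elts (b i)" by metis
  have "\<exists>\<beta>\<in>elts \<kappa>. b ` I \<subseteq> elts \<beta>"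
    by (rule reg) (use b(1) I countable_lesspoll_regular[OF \<kappa>] in auto)
  then obtain \<beta> where \<beta>: "\<beta> \<in> elts \<kappa>" "b ` I \<subseteq> elts \<beta>" by blast
  have "\<beta> \<in> g ` (\<Union>i\<in>I. A i)" using g \<beta>(1) by (rule subsetD)
  then obtain i where i: "i \<in> I" "\<beta> \<in> g ` A i" by blast
  then have "\<beta> \<in> elts (b i)" using b(2)[OF i(1)] \<beta>(1) by blast
  then have "b i \<notin> elts \<beta>" by (rule mem_asym)
  then show False using \<beta>(2) i(1) by blast
qed

lemma H_transitive: "x \<in> H \<kappa> \<Longrightarrow> elts x \<subseteq> H \<kappa>"
proof
  fix y assume "x \<in> H \<kappa>" "y \<in> elts x"
  then have "trans_closure y \<subseteq> trans_closure x" "trans_closure x \<prec> elts \<kappa>"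
    using elts_subset_trans_closure[of x] trans_closure_mono[of y x] unfolding H_def by blast+
  then show "y \<in> H \<kappa>" using subset_lesspoll[of "trans_closure y"] by (simp add: H_def)
qed

lemma trans_closure_subset_H: "x \<in> H \<kappa> \<Longrightarrow> trans_closure x \<subseteq> H \<kappa>"
  using H_transitive by (intro trans_closure_least)

lemma countable_elts_in_H:
  assumes "uncountable_regular \<kappa>" "countable (elts x)" "elts x \<subseteq> H \<kappa>" shows "x \<in> H \<kappa>"
proof -
  let ?U = "\<Union>y\<in>elts x. insert y (trans_closure y)"
  have "?U \<prec> elts \<kappa>"
  proof (rule countable_UN_lesspoll_regular[OF assms(1,2)])
    fix y assume "y \<in> elts x"
    then have *: "trans_closure y \<prec> elts \<kappa>" using assms(3) unfolding H_def by blast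
    have "(\<Union>Z\<in>{{y}, trans_closure y}. Z) \<prec> elts \<kappa>"
      by (rule countable_UN_lesspoll_regular[OF assms(1)])
        (use * countable_lesspoll_regular[OF assms(1)] in auto)
    then show "insert y (trans_closure y) \<prec> elts \<kappa>" by simp
  qed
  moreover have "trans_closure x \<subseteq> ?U"
  proof (rule trans_closure_least)
    show "elts x \<subseteq> ?U" by blast
    show "elts z \<subseteq> ?U" if "z \<in> ?U" for z
      using that elts_subset_trans_closure[of z] trans_closure_mono by blast
  qed
  ultimately show ?thesis using subset_lesspoll[of "trans_closure x"] by (simp add: H_def)
qed

lemma vset_in_H:
  assumes "uncountable_regular \<kappa>" "countable A" "A \<subseteq> H \<kappa>" shows "vset A \<in> H \<kappa>"
  using countable_elts_in_H[OF assms(1), of "vset A"] assms(2,3) by (simp add: elts_vset_countable)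

lemma vpair_in_H:
  assumes "uncountable_regular \<kappa>" "x \<in> H \<kappa>" "y \<in> H \<kappa>" shows "vpair x y \<in> H \<kappa>"
proof -
  have "vset {x} \<in> H \<kappa>" "vset {x, y} \<in> H \<kappa>" using assms(2,3) by (auto intro: vset_in_H[OF assms(1)])
  then show ?thesis unfolding vpair_def by (intro vset_in_H[OF assms(1)]) auto
qed

lemma vseq_in_H:
  assumes "uncountable_regular \<kappa>" "countable (elts \<alpha>)" "elts \<alpha> \<subseteq> H \<kappa>" "f ` elts \<alpha> \<subseteq> H \<kappa>"
  shows "vseq \<alpha> f \<in> H \<kappa>"
  unfolding vseq_def
proof (rule vset_in_H[OF assms(1)])
  show "(\<lambda>i. vpair i (f i)) ` elts \<alpha> \<subseteq> H \<kappa>" using assms(3,4) vpair_in_H[OF assms(1)] by blast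
qed (use assms(2) in simp)

lemma omega1_subset_H:
  assumes "uncountable_regular \<kappa>" shows "elts omega1 \<subseteq> H \<kappa>"
proof
  fix \<alpha> :: 'a assume "\<alpha> \<in> elts omega1"
  then have "countable (trans_closure \<alpha>)"
    using Ord_trans_closure omega1_Ord omega1_countable countable_subset by blast
  then show "\<alpha> \<in> H \<kappa>" unfolding H_def using countable_lesspoll_regular[OF assms] by blast
qed

text \<open>
  Every member of \<open>H \<kappa>\<close> is coded by a relation on some infinite cardinal \<open>\<mu> < \<kappa>\<close>, and there are
  at most \<open>2\<^sup>\<mu>\<close> such codes. As \<open>\<mu> < 2\<^sup>\<mu>\<close>, the number of cardinals below \<open>\<kappa>\<close> is at most \<open>2\<^bsup><\<kappa>\<^esup>\<close>
  as well, and the union over all \<open>\<mu>\<close> stays within this bound.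
\<close>

lemma H_lepoll_weak_power:
  fixes \<kappa> :: "'v::zfc_universe"
  assumes \<kappa>: "uncountable_regular \<kappa>"
  shows "H \<kappa> \<lesssim> elts (weak_power \<kappa>)"
proof -
  let ?W = "elts (weak_power \<kappa>)"
  define M where "M = {\<mu> \<in> elts \<kappa>. Card \<mu>}"
  have "small (\<Union>\<mu>\<in>M. elts (vcard (vpow \<mu>)))"
    by (rule small_UN[OF small_subset[OF small_elts] small_elts]) (auto simp: M_def)
  then have W: "?W = (\<Union>\<mu>\<in>M. elts (vcard (vpow \<mu>)))"
    unfolding weak_power_def M_def by (rule elts_vset)
  have pow: "Pow (elts \<mu>) \<approx> elts (vcard (vpow \<mu>))" for \<mu> :: 'v
    using elts_vpow_eqpoll[of \<mu>] Card_vcard_eqpoll[of "vpow \<mu>"] eqpoll_sym eqpoll_trans by blast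
  have M_W: "M \<subseteq> ?W"
  proof
    fix \<mu> assume \<mu>: "\<mu> \<in> M"
    have "elts \<mu> \<prec> elts (vcard (vpow \<mu>))"
      using lesspoll_Pow_self pow by (rule lesspoll_eq_trans)
    then have "\<mu> \<in> elts (vcard (vpow \<mu>))"
      using \<mu> Card_vcard_eqpoll[of "vpow \<mu>"] unfolding M_def by (blast intro: Card_lesspoll_imp_mem)
    then show "\<mu> \<in> ?W" unfolding W using \<mu> by blast
  qed
  define C where "C \<mu> = {x :: 'v. insert x (trans_closure x) \<lesssim> elts \<mu>}" for \<mu> :: 'v
  have C: "C \<mu> \<lesssim> ?W" if \<mu>: "\<mu> \<in> M" "infinite (elts \<mu>)" for \<mu>
  proof -
    have "C \<mu> \<lesssim> Pow (elts \<mu> \<times> elts \<mu>) \<times> elts \<mu>" unfolding C_def by (rule hereditary_lepoll_codes)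
    also have "\<dots> \<lesssim> Pow (elts \<mu>)" using \<mu>(2) by (rule codes_lepoll_Pow)
    also have "\<dots> \<approx> elts (vcard (vpow \<mu>))" by (rule pow)
    also have "\<dots> \<lesssim> ?W" unfolding W using \<mu>(1) by (blast intro: subset_imp_lepoll)
    finally show ?thesis .
  qed
  have cover: "\<exists>\<mu>\<in>M. infinite (elts \<mu>) \<and> x \<in> C \<mu>" if x: "x \<in> H \<kappa>" for x
  proof -
    obtain f :: "nat \<Rightarrow> 'v" where f: "inj f" "small (range f)" using nat_embeds_small by blast
    \<comment> \<open>The range of \<open>f\<close> only serves to make the coding cardinal infinite.\<close>
    define B where "B = insert x (trans_closure x) \<union> range f"
    have "(\<Union>Z\<in>{{x}, trans_closure x, range f}. Z) \<prec> elts \<kappa>"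
      by (rule countable_UN_lesspoll_regular[OF \<kappa>])
        (use x countable_lesspoll_regular[OF \<kappa>] in \<open>auto simp: H_def\<close>)
    then have B: "B \<prec> elts \<kappa>" by (simp add: B_def Un_assoc)
    have sB: "elts (vset B) = B" unfolding B_def
      by (intro elts_vset small_Un small_insert small_trans_closure f(2))
    define \<mu> where "\<mu> = vcard (vset B)"
    have \<mu>: "Card \<mu>" "elts \<mu> \<approx> B" using Card_vcard_eqpoll[of "vset B"] unfolding \<mu>_def sB by auto
    have "elts \<mu> \<prec> elts \<kappa>" using \<mu>(2) B by (rule eq_lesspoll_trans)
    then have "\<mu> \<in> M" using \<mu>(1) \<kappa> unfolding M_def uncountable_regular_def regular_def
      by (blast intro: Card_lesspoll_imp_mem)
    moreover have "infinite (elts \<mu>)"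
      using \<mu>(2) range_inj_infinite[OF f(1)] unfolding B_def by (simp add: eqpoll_finite_iff)
    moreover have "insert x (trans_closure x) \<lesssim> B" unfolding B_def by (rule subset_imp_lepoll) blast
    then have "x \<in> C \<mu>" unfolding C_def using eqpoll_sym[OF \<mu>(2)] lepoll_trans2 by blast
    ultimately show ?thesis by blast
  qed
  let ?I = "{\<mu> \<in> M. infinite (elts \<mu>)}"
  show ?thesis
  proof (cases "H \<kappa> = {}")
    case False
    then obtain \<mu> where \<mu>: "\<mu> \<in> M" "infinite (elts \<mu>)" using cover by blast
    have "elts \<mu> \<lesssim> Pow (elts \<mu>)" by (rule lepoll_Pow_self)
    also have "\<dots> \<approx> elts (vcard (vpow \<mu>))" by (rule pow)
    also have "\<dots> \<lesssim> ?W" unfolding W using \<mu>(1) by (blast intro: subset_imp_lepoll)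
    finally have inf: "infinite ?W" using \<mu>(2) lepoll_trans unfolding infinite_le_lepoll by blast
    have "H \<kappa> \<lesssim> (\<Union>\<mu>\<in>?I. C \<mu>)" using cover by (blast intro: subset_imp_lepoll)
    also have "\<dots> \<lesssim> ?W"
    proof (rule UN_lepoll[OF inf])
      show "?I \<lesssim> ?W" by (rule subset_imp_lepoll) (use M_W in blast)
    qed (use C in blast)
    finally show ?thesis .
  qed simp
qed

lemma H_lesspoll:
  assumes "uncountable_regular \<kappa>" "regular \<theta>" "weak_power \<kappa> \<in> elts \<theta>"
  shows "H \<kappa> \<prec> elts \<theta>"
proof (rule lesspoll_trans1[OF H_lepoll_weak_power[OF assms(1)]])
  show "elts (weak_power \<kappa>) \<prec> elts \<theta>" using assms(2,3) unfolding regular_def Card_def by blast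
qed

lemma H_subset_H:
  assumes "H \<kappa> \<prec> elts \<theta>" shows "H \<kappa> \<subseteq> H \<theta>"
proof
  fix x assume "x \<in> H \<kappa>"
  then have "trans_closure x \<subseteq> H \<kappa>" by (rule trans_closure_subset_H)
  then show "x \<in> H \<theta>" using assms subset_lesspoll[of "trans_closure x"] by (simp add: H_def)
qed

lemma stationary_countable_in_H:
  assumes "uncountable_regular \<kappa>" "H \<kappa> \<prec> elts \<theta>" "stationary_countable \<kappa> S"
  shows "S \<in> H \<theta>"
proof -
  have "elts S \<subseteq> H \<kappa>"
    using assms(1,3) countable_elts_in_H unfolding stationary_countable_def by blast
  then have "trans_closure S \<subseteq> H \<kappa>" using H_transitive by (intro trans_closure_least)
  then show ?thesis using assms(2) subset_lesspoll[of "trans_closure S"] by (simp add: H_def)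
qed

lemma trans_closure_irrefl: "x \<notin> trans_closure x"
  using wf_not_refl[OF wf_trancl[OF wf_mem]] unfolding trans_closure_def by blast

section \<open>Closure points of stationary sets\<close>

text \<open>
  Each member of \<open>triple p\<close> other than \<open>p\<close> has \<open>p\<close> in its transitive closure. This singles out
  \<open>p\<close>, although a stationary set only controls functions of unordered finite sets.
\<close>

definition triple :: "'v::zfc_universe \<Rightarrow> 'v set" where
  "triple p = {p, vset {p}, vset {vset {p}}}"

text \<open>The Zermelo numerals.\<close>

primrec nested_empty :: "nat \<Rightarrow> 'v::zfc_universe" where
  "nested_empty 0 = vset {}"
| "nested_empty (Suc n) = vset {nested_empty n}"

lemma triple_inject:
  assumes "triple p = triple q" shows "p = q"
proof (rule ccontr)
  assume "p \<noteq> q"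
  have *: "x \<in> trans_closure y" if "y \<in> triple x" "y \<noteq> x" for x y :: 'a
    using that elts_subset_trans_closure[of "vset {x}"] elts_subset_trans_closure[of "vset {vset {x}}"]
      trans_closure_mono[of "vset {x}" "vset {vset {x}}"] unfolding triple_def by auto
  have "p \<in> triple q" "q \<in> triple p" using assms unfolding triple_def by blast+
  then have "q \<in> trans_closure p" "p \<in> trans_closure q" using * \<open>p \<noteq> q\<close> by blast+
  then show False using trans_closure_mono trans_closure_irrefl by blast
qed

lemma card_triple: "card (triple p) = 3"
proof -
  have 1: "x \<noteq> vset {x}" for x :: 'a using mem_irrefl[of x] elts_vset_singleton[of x] by (metis insertI1)
  have 2: "p \<noteq> vset {vset {p}}"
    using mem_asym[of p "vset {p}"] elts_vset_singleton[of p] elts_vset_singleton[of "vset {p}"]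
    by (metis insertI1)
  have "p \<noteq> vset {p}" "vset {p} \<noteq> vset {vset {p}}" by (rule 1)+
  then show ?thesis using 2 unfolding triple_def by simp
qed

lemma inj_nested_empty: "inj (nested_empty :: nat \<Rightarrow> 'v::zfc_universe)"
proof (rule injI)
  have "elts (vset {} :: 'v) = {}" by (rule elts_vset[OF small_empty])
  then have e: "vset {} \<noteq> vset {x}" for x :: 'v
    using elts_vset_singleton[of x] insert_not_empty by metis
  have s: "x = y" if "vset {x} = vset {y}" for x y :: 'v
  proof -
    have "elts (vset {x}) = elts (vset {y})" using that by (rule arg_cong)
    then show ?thesis unfolding elts_vset_singleton by (rule singleton_inject)
  qed
  fix m n show "nested_empty m = (nested_empty n :: 'v) \<Longrightarrow> m = n"
  proof (induction m arbitrary: n)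
    case 0 then show ?case using e by (cases n) simp_all
  next
    case (Suc m)
    show ?case
    proof (cases n)
      case 0 then show ?thesis using Suc.prems e[of "nested_empty m"] by simp
    next
      case (Suc k)
      then have "nested_empty m = (nested_empty k :: 'v)" using Suc.prems s by simp
      then show ?thesis using Suc.IH \<open>n = Suc k\<close> by simp
    qed
  qed
qed

text \<open>
  Stationarity provides closure under a single function of finite sets. Such a function can use sets
  with at most two elements for the formation of unordered pairs, and therefore of ordered pairs and
  of codes for natural numbers, while the sets \<open>triple p\<close> remain free to list the members of \<open>g w\<close>.
\<close>

lemma stationary_countable_closed:
  fixes \<kappa> :: "'v::zfc_universe"
  assumes \<kappa>: "uncountable_regular \<kappa>" and S: "stationary_countable \<kappa> S"
    and g: "\<And>w. w \<in> H \<kappa> \<Longrightarrow> countable (g w) \<and> g w \<subseteq> H \<kappa>"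
  shows "\<exists>N\<in>elts S. elts N \<noteq> {} \<and> elts N \<subseteq> H \<kappa> \<and> countable (elts N) \<and>
    (\<forall>x\<in>elts N. \<forall>y\<in>elts N. vpair x y \<in> elts N) \<and> (\<forall>w\<in>elts N. g w \<subseteq> elts N)"
proof -
  \<comment> \<open>\<open>P e z\<close>: the finite set \<open>e\<close> requests the \<open>n\<close>-th member of \<open>g w\<close>, and \<open>z\<close> is that member.\<close>
  define P where "P e z \<longleftrightarrow> (\<exists>n w. w \<in> H \<kappa> \<and> g w \<noteq> {} \<and>
    e = triple (vpair (nested_empty n) w) \<and> z = from_nat_into (g w) n)" for e z
  define F where "F e = (if \<exists>z. P e z then SOME z. P e z else vset e)" for e
  have F_code: "F (triple (vpair (nested_empty n) w)) = from_nat_into (g w) n"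
    if "w \<in> H \<kappa>" "g w \<noteq> {}" for n w
  proof -
    let ?e = "triple (vpair (nested_empty n) w)"
    have "P ?e z \<longleftrightarrow> z = from_nat_into (g w) n" for z
    proof
      assume "P ?e z"
      then obtain m v where mv: "?e = triple (vpair (nested_empty m) v)" "z = from_nat_into (g v) m"
        unfolding P_def by blast
      from triple_inject[OF mv(1)] have "n = m" "w = v"
        using injD[OF inj_nested_empty] by (metis vpair_inject)+
      then show "z = from_nat_into (g w) n" using mv(2) by simp
    qed (use that P_def in blast)
    then have "P ?e = (\<lambda>z. z = from_nat_into (g w) n)" by (rule ext)
    then show ?thesis unfolding F_def by simp
  qed
  have F_small: "F e = vset e" if "card e < 3" for e
    using that card_triple unfolding F_def P_def by (metis less_irrefl)
  have "F e \<in> H \<kappa>" if "finite e" "e \<subseteq> H \<kappa>" for e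
  proof (cases "\<exists>z. P e z")
    case True
    then have "P e (F e)" unfolding F_def using someI_ex[of "P e"] by simp
    then obtain n w where "w \<in> H \<kappa>" "g w \<noteq> {}" "F e = from_nat_into (g w) n" unfolding P_def by blast
    then show ?thesis using g[of w] from_nat_into[of "g w" n] by auto
  next
    case False
    then have "F e = vset e" unfolding F_def by (rule if_not_P)
    then show ?thesis using vset_in_H[OF \<kappa> countable_finite[OF that(1)] that(2)] by simp
  qed
  then have F_H: "\<forall>e. finite e \<and> e \<subseteq> H \<kappa> \<longrightarrow> F e \<in> H \<kappa>" by blast
  have "stationary_in (H \<kappa>) (elts ` elts S)" using S unfolding stationary_countable_def by blast
  then have "\<exists>X\<in>elts ` elts S. \<forall>e. finite e \<and> e \<subseteq> X \<longrightarrow> F e \<in> X"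
    using F_H unfolding stationary_in_def by simp
  then obtain N where N: "N \<in> elts S" and cl: "\<And>e. finite e \<Longrightarrow> e \<subseteq> elts N \<Longrightarrow> F e \<in> elts N"
    by blast
  have NH: "elts N \<subseteq> H \<kappa>" "countable (elts N)" using S N unfolding stationary_countable_def by blast+
  have pair: "vset {x, y} \<in> elts N" if "x \<in> elts N" "y \<in> elts N" for x y
    using cl[of "{x, y}"] F_small[of "{x, y}"] that by (simp add: card_insert_if)
  then have single: "vset {x} \<in> elts N" if "x \<in> elts N" for x using that by (metis insert_absorb2)
  have vp: "vpair x y \<in> elts N" if "x \<in> elts N" "y \<in> elts N" for x y
    unfolding vpair_def using that pair single by blast
  have empty: "vset {} \<in> elts N" using cl[of "{}"] F_small[of "{}"] by simp
  have nest: "nested_empty n \<in> elts N" for n by (induction n) (auto simp: empty single)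
  have "g w \<subseteq> elts N" if w: "w \<in> elts N" for w
  proof
    fix z assume z: "z \<in> g w"
    have wH: "w \<in> H \<kappa>" using w NH(1) by blast
    obtain n where n: "z = from_nat_into (g w) n"
      using from_nat_into_surj[OF _ z] g[OF wH] by metis
    let ?p = "vpair (nested_empty n) w"
    have "F (triple ?p) \<in> elts N"
      by (rule cl) (use vp[OF nest w] single in \<open>auto simp: triple_def\<close>)
    moreover have "F (triple ?p) = z" unfolding n by (rule F_code[OF wH]) (use z in blast)
    ultimately show "z \<in> elts N" by simp
  qed
  then show ?thesis using N NH vp empty by blast
qed

section \<open>Extending chains\<close>

text \<open>
  The new entries, at positions in \<open>(\<delta>, \<alpha>]\<close>, are constrained by \<open>R\<close>. In the application, \<open>R \<beta>\<close> is
  the label \<open>S i\<close> with \<open>\<beta> \<in> T i\<close> if there is one, which is unique by disjointness.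
\<close>

definition chain_extension ::
  "'v::zfc_universe \<Rightarrow> ('v \<Rightarrow> 'v) \<Rightarrow> 'v \<Rightarrow> ('v \<Rightarrow> 'v) \<Rightarrow> 'v \<Rightarrow> ('v \<Rightarrow> 'v) \<Rightarrow> bool" where
  "chain_extension \<kappa> R \<delta> Q \<alpha> Q' \<longleftrightarrow>
     continuous_chain \<kappa> (vsucc \<alpha>) Q' \<and> (\<forall>\<beta>\<in>elts (vsucc \<delta>). Q' \<beta> = Q \<beta>) \<and>
     (\<forall>\<beta>\<in>elts (vsucc \<alpha>) - elts (vsucc \<delta>). Q' \<beta> \<in> elts (R \<beta>))"

lemma chain_extension_trans:
  assumes "chain_extension \<kappa> R \<delta> Q \<epsilon> P" "chain_extension \<kappa> R \<epsilon> P \<alpha> Q'"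
    "elts (vsucc \<delta>) \<subseteq> elts (vsucc \<epsilon>)"
  shows "chain_extension \<kappa> R \<delta> Q \<alpha> Q'"
  unfolding chain_extension_def
proof (intro conjI ballI)
  show "continuous_chain \<kappa> (vsucc \<alpha>) Q'" using assms(2) unfolding chain_extension_def by blast
  show "Q' \<beta> = Q \<beta>" if "\<beta> \<in> elts (vsucc \<delta>)" for \<beta>
  proof -
    have "\<beta> \<in> elts (vsucc \<epsilon>)" using that assms(3) by blast
    then have "Q' \<beta> = P \<beta>" using assms(2) unfolding chain_extension_def by blast
    also have "P \<beta> = Q \<beta>" using assms(1) that unfolding chain_extension_def by blast
    finally show ?thesis .
  qed
  show "Q' \<beta> \<in> elts (R \<beta>)" if "\<beta> \<in> elts (vsucc \<alpha>) - elts (vsucc \<delta>)" for \<beta>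
  proof (cases "\<beta> \<in> elts (vsucc \<epsilon>)")
    case True
    then have "Q' \<beta> = P \<beta>" using assms(2) unfolding chain_extension_def by blast
    moreover have "P \<beta> \<in> elts (R \<beta>)" using assms(1) that True unfolding chain_extension_def by blast
    ultimately show ?thesis by simp
  next
    case False
    then show ?thesis using assms(2) that unfolding chain_extension_def by blast
  qed
qed

lemma continuous_chain_cong:
  assumes "Ord \<eta>" "\<And>\<beta>. \<beta> \<in> elts \<eta> \<Longrightarrow> Q \<beta> = Q' \<beta>" "continuous_chain \<kappa> \<eta> Q"
  shows "continuous_chain \<kappa> \<eta> Q'"
proof -
  have "(\<Union>\<beta>\<in>elts \<alpha>. elts (Q' \<beta>)) = (\<Union>\<beta>\<in>elts \<alpha>. elts (Q \<beta>))" if "\<alpha> \<in> elts \<eta>" for \<alpha>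
    using assms(2) Ord_trans[OF assms(1) that] by simp
  then show ?thesis using assms(2,3) unfolding continuous_chain_def by simp
qed

lemma chain_extension_cong:
  assumes "chain_extension \<kappa> R \<delta> Q \<alpha> Q'" "\<And>\<beta>. \<beta> \<in> elts (vsucc \<delta>) \<Longrightarrow> P \<beta> = Q \<beta>"
  shows "chain_extension \<kappa> R \<delta> P \<alpha> Q'"
  using assms unfolding chain_extension_def by simp

lemma continuous_chain_append:
  assumes \<alpha>: "Ord \<alpha>" and Q: "continuous_chain \<kappa> \<alpha> Q" and N: "elts N \<subseteq> H \<kappa>" "countable (elts N)"
    and succ: "\<And>\<beta>. \<alpha> = vsucc \<beta> \<Longrightarrow> Q \<beta> \<in> elts N"
    and lim: "Limit \<alpha> \<Longrightarrow> elts N = (\<Union>\<beta>\<in>elts \<alpha>. elts (Q \<beta>))"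
  shows "continuous_chain \<kappa> (vsucc \<alpha>) (Q(\<alpha> := N))"
proof -
  let ?Q = "Q(\<alpha> := N)"
  have eq: "?Q \<beta> = Q \<beta>" if "\<beta> \<in> elts \<alpha>" for \<beta> using that mem_irrefl[of \<alpha>] by auto
  have 1: "elts (?Q \<beta>) \<subseteq> H \<kappa> \<and> countable (elts (?Q \<beta>))" if "\<beta> \<in> elts (vsucc \<alpha>)" for \<beta>
    using that Q N unfolding continuous_chain_def by auto
  have 2: "?Q \<beta> \<in> elts (?Q (vsucc \<beta>))" if b: "\<beta> \<in> elts (vsucc \<alpha>)" "vsucc \<beta> \<in> elts (vsucc \<alpha>)" for \<beta>
  proof -
    have \<beta>: "\<beta> \<in> elts \<alpha>"
      using b mem_irrefl[of \<alpha>] mem_asym[of \<alpha> "vsucc \<alpha>"] by (metis elts_vsucc insertE insertI1)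
    show ?thesis
    proof (cases "vsucc \<beta> = \<alpha>")
      case True then show ?thesis using succ[of \<beta>] eq[OF \<beta>] by simp
    next
      case False
      then have "vsucc \<beta> \<in> elts \<alpha>" using b by simp
      then show ?thesis using eq \<beta> Q unfolding continuous_chain_def by simp
    qed
  qed
  have 3: "elts (?Q \<beta>) = (\<Union>\<gamma>\<in>elts \<beta>. elts (?Q \<gamma>))" if b: "\<beta> \<in> elts (vsucc \<alpha>)" "Limit \<beta>" for \<beta>
  proof -
    have "\<gamma> \<in> elts \<alpha>" if "\<gamma> \<in> elts \<beta>" for \<gamma> using that b Ord_trans[OF \<alpha>] by auto
    then have un: "(\<Union>\<gamma>\<in>elts \<beta>. elts (?Q \<gamma>)) = (\<Union>\<gamma>\<in>elts \<beta>. elts (Q \<gamma>))" using eq by simp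
    have "elts (?Q \<beta>) = (\<Union>\<gamma>\<in>elts \<beta>. elts (Q \<gamma>))"
    proof (cases "\<beta> = \<alpha>")
      case True
      then show ?thesis using lim b(2) by simp
    next
      case False
      then have \<beta>: "\<beta> \<in> elts \<alpha>" using b(1) by simp
      then have "elts (Q \<beta>) = (\<Union>\<gamma>\<in>elts \<beta>. elts (Q \<gamma>))"
        using Q b(2) unfolding continuous_chain_def by blast
      then show ?thesis using eq[OF \<beta>] by simp
    qed
    then show ?thesis using un by simp
  qed
  show ?thesis unfolding continuous_chain_def
    by (intro conjI[OF _ conjI] ballI impI) (rule 1, assumption | rule 2, assumption+ | rule 3, assumption+)+
qed

lemma chain_code_in_H:
  assumes \<kappa>: "uncountable_regular \<kappa>" and \<delta>: "\<delta> \<in> elts omega1" and Q: "continuous_chain \<kappa> (vsucc \<delta>) Q"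
  shows "Q ` elts (vsucc \<delta>) \<subseteq> H \<kappa>" "vseq (vsucc \<delta>) Q \<in> H \<kappa>"
proof -
  show *: "Q ` elts (vsucc \<delta>) \<subseteq> H \<kappa>"
  proof (rule image_subsetI)
    fix \<beta> assume "\<beta> \<in> elts (vsucc \<delta>)"
    then have "elts (Q \<beta>) \<subseteq> H \<kappa>" "countable (elts (Q \<beta>))"
      using Q unfolding continuous_chain_def by blast+
    then show "Q \<beta> \<in> H \<kappa>" using countable_elts_in_H[OF \<kappa>] by simp
  qed
  have \<delta>': "vsucc \<delta> \<in> elts omega1" using \<delta> by (rule omega1_vsucc)
  have "elts (vsucc \<delta>) \<subseteq> H \<kappa>" using omega1_trans[OF \<delta>'] omega1_subset_H[OF \<kappa>] by blast
  then show "vseq (vsucc \<delta>) Q \<in> H \<kappa>" by (rule vseq_in_H[OF \<kappa> omega1_countable[OF \<delta>'] _ *])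
qed

text \<open>
  A closure point of the constant operation with value \<open>insert (Q \<delta>) c\<close> can be appended.
\<close>

lemma chain_extension_successor:
  assumes \<kappa>: "uncountable_regular \<kappa>" and R: "stationary_countable \<kappa> (R (vsucc \<delta>))"
    and \<delta>: "\<delta> \<in> elts omega1" and Q: "continuous_chain \<kappa> (vsucc \<delta>) Q"
    and c: "countable c" "c \<subseteq> H \<kappa>"
  shows "\<exists>Q'. chain_extension \<kappa> R \<delta> Q (vsucc \<delta>) Q' \<and> c \<subseteq> elts (Q' (vsucc \<delta>))"
proof -
  have "Q \<delta> \<in> H \<kappa>" using chain_code_in_H(1)[OF \<kappa> \<delta> Q] by auto
  then have g: "countable (insert (Q \<delta>) c) \<and> insert (Q \<delta>) c \<subseteq> H \<kappa>" using c by simp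
  obtain N where N: "N \<in> elts (R (vsucc \<delta>))" "elts N \<noteq> {}" "elts N \<subseteq> H \<kappa>" "countable (elts N)"
    "\<And>w. w \<in> elts N \<Longrightarrow> insert (Q \<delta>) c \<subseteq> elts N"
    using stationary_countable_closed[OF \<kappa> R, of "\<lambda>_. insert (Q \<delta>) c"] g by metis
  then have cN: "insert (Q \<delta>) c \<subseteq> elts N" by blast
  let ?\<alpha> = "vsucc \<delta>"
  have "continuous_chain \<kappa> (vsucc ?\<alpha>) (Q(?\<alpha> := N))"
  proof (rule continuous_chain_append[OF _ Q N(3,4)])
    show "Ord ?\<alpha>" using \<delta> omega1_Ord Ord_vsucc by blast
    show "Q \<beta> \<in> elts N" if "?\<alpha> = vsucc \<beta>" for \<beta> using that cN by simp
  qed (simp add: Limit_not_vsucc)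
  then have "chain_extension \<kappa> R \<delta> Q ?\<alpha> (Q(?\<alpha> := N))"
    unfolding chain_extension_def using N(1) mem_irrefl[of ?\<alpha>] by auto
  then show ?thesis using cN by (intro exI[of _ "Q(?\<alpha> := N)"]) simp
qed

text \<open>
  At a limit \<open>\<alpha>\<close> take a closure point \<open>N\<close> of \<open>R \<alpha>\<close> that contains \<open>Q\<close> and is closed under a choice of
  extensions to lengths below \<open>\<alpha>\<close>. Extending inside \<open>N\<close> in \<open>\<omega>\<close> steps, with lengths cofinal in \<open>\<alpha>\<close>
  and absorbing one member of \<open>N\<close> at a time, gives a chain with union \<open>N\<close>.
\<close>

lemma chain_extension_limit:
  fixes \<kappa> :: "'v::zfc_universe"
  assumes \<kappa>: "uncountable_regular \<kappa>" and R: "stationary_countable \<kappa> (R \<alpha>)"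
    and \<alpha>: "\<alpha> \<in> elts omega1" "Limit \<alpha>" and \<delta>: "\<delta> \<in> elts \<alpha>"
    and Q: "continuous_chain \<kappa> (vsucc \<delta>) Q"
    and c: "countable c" "c \<subseteq> H \<kappa>"
    and IH: "\<And>\<epsilon> \<zeta> P x. \<zeta> \<in> elts \<alpha> \<Longrightarrow> \<epsilon> \<in> elts \<zeta> \<Longrightarrow> continuous_chain \<kappa> (vsucc \<epsilon>) P \<Longrightarrow> x \<in> H \<kappa> \<Longrightarrow>
      \<exists>Q'. chain_extension \<kappa> R \<epsilon> P \<zeta> Q' \<and> x \<in> elts (Q' \<zeta>)"
  shows "\<exists>Q'. chain_extension \<kappa> R \<delta> Q \<alpha> Q' \<and> c \<subseteq> elts (Q' \<alpha>)"
proof -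
  have ord: "Ord \<alpha>" using \<alpha>(1) by (rule omega1_Ord)
  have sub: "elts \<alpha> \<subseteq> elts omega1" using omega1_trans[OF \<alpha>(1)] by blast
  have succ: "vsucc \<beta> \<in> elts \<alpha>" if "\<beta> \<in> elts \<alpha>" for \<beta> using \<alpha>(2) that unfolding Limit_def by blast
  \<comment> \<open>\<open>G w q\<close>: \<open>w\<close> codes a chain together with a length \<open>\<zeta>\<close> and a point \<open>x\<close> to absorb, and \<open>q\<close> codes a solution.\<close>
  define G where "G w q \<longleftrightarrow> (\<exists>\<epsilon> P \<zeta> x Q'. w = vpair (vseq (vsucc \<epsilon>) P) (vpair \<zeta> x) \<and>
    q = vseq (vsucc \<zeta>) Q' \<and> \<epsilon> \<in> elts \<zeta> \<and> \<zeta> \<in> elts \<alpha> \<and>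
    chain_extension \<kappa> R \<epsilon> P \<zeta> Q' \<and> x \<in> elts (Q' \<zeta>))" for w q
  define E where "E w = (if \<exists>q. G w q then {SOME q. G w q} else {})" for w
  define g where "g w = E w \<union> (if countable (elts w) then elts w else {}) \<union>
    (elts \<alpha> \<union> c \<union> {vseq (vsucc \<delta>) Q})" for w
  have E: "G w q" if "q \<in> E w" for w q
    using that someI_ex[of "G w"] unfolding E_def by (auto split: if_splits)
  have GH: "q \<in> H \<kappa>" if G: "G w q" for w q
  proof -
    obtain \<zeta> Q' where "\<zeta> \<in> elts \<alpha>" "continuous_chain \<kappa> (vsucc \<zeta>) Q'" "q = vseq (vsucc \<zeta>) Q'"
      using G unfolding G_def chain_extension_def by blast
    then show ?thesis using chain_code_in_H(2)[OF \<kappa>] sub by blast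
  qed
  have g: "countable (g w) \<and> g w \<subseteq> H \<kappa>" if w: "w \<in> H \<kappa>" for w
  proof
    have "countable (E w)" unfolding E_def by simp
    then show "countable (g w)" unfolding g_def using omega1_countable[OF \<alpha>(1)] c(1) by simp
    have "elts \<alpha> \<subseteq> H \<kappa>" using sub omega1_subset_H[OF \<kappa>] by blast
    moreover have "vseq (vsucc \<delta>) Q \<in> H \<kappa>" using chain_code_in_H(2)[OF \<kappa> _ Q] sub \<delta> by blast
    moreover have "E w \<subseteq> H \<kappa>" using E GH by blast
    ultimately show "g w \<subseteq> H \<kappa>" unfolding g_def using c(2) H_transitive[OF w] by simp
  qed
  obtain N where N: "N \<in> elts (R \<alpha>)" "elts N \<noteq> {}" "elts N \<subseteq> H \<kappa>" "countable (elts N)"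
    and pair: "\<And>x y. x \<in> elts N \<Longrightarrow> y \<in> elts N \<Longrightarrow> vpair x y \<in> elts N"
    and gN: "\<And>w. w \<in> elts N \<Longrightarrow> g w \<subseteq> elts N"
    using stationary_countable_closed[OF \<kappa> R, of g] g by metis
  have cN: "c \<subseteq> elts N" and \<alpha>N: "elts \<alpha> \<subseteq> elts N" and QN: "vseq (vsucc \<delta>) Q \<in> elts N"
    using gN N(2) unfolding g_def by blast+
  have EN: "E w \<subseteq> elts N" if "w \<in> elts N" for w using gN[OF that] unfolding g_def by blast
  have ctN: "elts w \<subseteq> elts N" if "w \<in> elts N" "countable (elts w)" for w
    using gN[OF that(1)] that(2) unfolding g_def by simp
  have step: "\<exists>Q'. chain_extension \<kappa> R \<epsilon> P \<zeta> Q' \<and> x \<in> elts (Q' \<zeta>) \<and> vseq (vsucc \<zeta>) Q' \<in> elts N"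
    if \<zeta>: "\<zeta> \<in> elts \<alpha>" "\<epsilon> \<in> elts \<zeta>" and P: "continuous_chain \<kappa> (vsucc \<epsilon>) P"
      "vseq (vsucc \<epsilon>) P \<in> elts N" and x: "x \<in> elts N" for \<epsilon> \<zeta> P x
  proof -
    let ?w = "vpair (vseq (vsucc \<epsilon>) P) (vpair \<zeta> x)"
    have w: "?w \<in> elts N" using pair P(2) x \<zeta>(1) \<alpha>N by blast
    obtain Q0 where "chain_extension \<kappa> R \<epsilon> P \<zeta> Q0" "x \<in> elts (Q0 \<zeta>)"
      using IH[OF \<zeta> P(1)] x N(3) by blast
    then have "G ?w (vseq (vsucc \<zeta>) Q0)" unfolding G_def using \<zeta> by blast
    then have "\<exists>q. G ?w q" by (rule exI)
    then have "E ?w = {SOME q. G ?w q}" unfolding E_def by (rule if_P)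
    then obtain q where q: "q \<in> E ?w" by blast
    then obtain \<epsilon>' P' \<zeta>' x' Q' where *: "?w = vpair (vseq (vsucc \<epsilon>') P') (vpair \<zeta>' x')"
      "q = vseq (vsucc \<zeta>') Q'" "chain_extension \<kappa> R \<epsilon>' P' \<zeta>' Q'" "x' \<in> elts (Q' \<zeta>')"
      using E[OF q] unfolding G_def by blast
    have eq: "\<epsilon>' = \<epsilon>" "\<And>\<beta>. \<beta> \<in> elts (vsucc \<epsilon>) \<Longrightarrow> P \<beta> = P' \<beta>" "\<zeta>' = \<zeta>" "x' = x"
      using *(1) unfolding vpair_inject vseq_eq_iff vsucc_inject by auto
    have "chain_extension \<kappa> R \<epsilon> P \<zeta> Q'"
      using chain_extension_cong[OF *(3)] eq by simp
    moreover have "q \<in> elts N" using q EN[OF w] by blast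
    ultimately show ?thesis using *(2,4) eq by blast
  qed
  have "elts \<alpha> \<noteq> {}" using \<delta> by blast
  from range_from_nat_into[OF this omega1_countable[OF \<alpha>(1)]]
  obtain a :: "nat \<Rightarrow> 'v" where a: "range a = elts \<alpha>" by (rule that)
  from range_from_nat_into[OF N(2,4)] obtain x :: "nat \<Rightarrow> 'v" where x: "range x = elts N" by (rule that)
  \<comment> \<open>Keeping the codes of the chains inside \<open>N\<close> is what allows each extension to be found in \<open>N\<close> again.\<close>
  define Inv where "Inv s \<longleftrightarrow> (case s of (\<epsilon>, P) \<Rightarrow> \<epsilon> \<in> elts \<alpha> \<and> elts (vsucc \<delta>) \<subseteq> elts (vsucc \<epsilon>) \<and>
    chain_extension \<kappa> R \<delta> Q \<epsilon> P \<and> vseq (vsucc \<epsilon>) P \<in> elts N)" for s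
  define Next where "Next n s s' \<longleftrightarrow> (case s of (\<epsilon>, P) \<Rightarrow> case s' of (\<zeta>, P') \<Rightarrow>
    \<epsilon> \<in> elts \<zeta> \<and> a n \<in> elts \<zeta> \<and> chain_extension \<kappa> R \<epsilon> P \<zeta> P' \<and> x n \<in> elts (P' \<zeta>))" for n s s'
  have "\<exists>f. \<forall>n. Inv (f n) \<and> Next n (f n) (f (Suc n))"
  proof (rule dependent_nat_choice)
    show "\<exists>s. Inv s"
    proof
      show "Inv (\<delta>, Q)" unfolding Inv_def chain_extension_def using \<delta> Q QN by auto
    qed
  next
    fix s n assume "Inv s"
    then obtain \<epsilon> P where s: "s = (\<epsilon>, P)" "\<epsilon> \<in> elts \<alpha>" "elts (vsucc \<delta>) \<subseteq> elts (vsucc \<epsilon>)"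
      "chain_extension \<kappa> R \<delta> Q \<epsilon> P" "vseq (vsucc \<epsilon>) P \<in> elts N"
      unfolding Inv_def by (cases s) simp
    have an: "a n \<in> elts \<alpha>" using a by blast
    have "Ord \<epsilon>" "Ord (a n)" using s(2) an Ord_elem[OF ord] by blast+
    then obtain \<zeta> where \<zeta>: "\<zeta> \<in> elts \<alpha>" "\<epsilon> \<in> elts \<zeta>" "a n \<in> elts \<zeta>"
      using Ord_linear[of \<epsilon> "a n"] succ[OF s(2)] succ[OF an] by (metis elts_vsucc insertCI)
    have P: "continuous_chain \<kappa> (vsucc \<epsilon>) P" using s(4) unfolding chain_extension_def by blast
    have xn: "x n \<in> elts N" using x by blast
    obtain P' where P': "chain_extension \<kappa> R \<epsilon> P \<zeta> P'" "x n \<in> elts (P' \<zeta>)" "vseq (vsucc \<zeta>) P' \<in> elts N"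
      using step[OF \<zeta>(1,2) P s(5) xn] by blast
    have "elts (vsucc \<epsilon>) \<subseteq> elts (vsucc \<zeta>)"
      using \<zeta>(2) Ord_trans[OF Ord_elem[OF ord \<zeta>(1)] \<zeta>(2)] by auto
    then have "Inv (\<zeta>, P')" unfolding Inv_def
      using \<zeta>(1) s(3) chain_extension_trans[OF s(4) P'(1) s(3)] P'(3) by auto
    moreover have "Next n s (\<zeta>, P')" unfolding Next_def s(1) using \<zeta> P' by simp
    ultimately show "\<exists>s'. Inv s' \<and> Next n s s'" by blast
  qed
  then obtain f where f: "\<And>n. Inv (f n)" "\<And>n. Next n (f n) (f (Suc n))" by blast
  define e P where "e n = fst (f n)" and "P n = snd (f n)" for n
  have e: "e n \<in> elts \<alpha>" and ext: "chain_extension \<kappa> R \<delta> Q (e n) (P n)"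
    and code: "vseq (vsucc (e n)) (P n) \<in> elts N" and \<delta>e: "elts (vsucc \<delta>) \<subseteq> elts (vsucc (e n))" for n
    using f(1)[of n] unfolding Inv_def e_def P_def by (auto simp: case_prod_beta)
  have e_less: "e n \<in> elts (e (Suc n))" and ae: "a n \<in> elts (e (Suc n))"
    and ext_Suc: "chain_extension \<kappa> R (e n) (P n) (e (Suc n)) (P (Suc n))"
    and xP: "x n \<in> elts (P (Suc n) (e (Suc n)))" for n
    using f(2)[of n] unfolding Next_def e_def P_def by (auto simp: case_prod_beta)
  have agree: "P n \<beta> = P m \<beta> \<and> \<beta> \<in> elts (vsucc (e n))" if "m \<le> n" "\<beta> \<in> elts (vsucc (e m))" for m n \<beta>
    using that(1)
  proof (induction n rule: dec_induct)
    case (step n)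
    then have b: "\<beta> \<in> elts (vsucc (e n))" by blast
    then have "P (Suc n) \<beta> = P n \<beta>" using ext_Suc unfolding chain_extension_def by blast
    moreover have "\<beta> \<in> elts (vsucc (e (Suc n)))"
      using b e_less[of n] Ord_trans[OF Ord_elem[OF ord e] e_less] by auto
    ultimately show ?case using step by simp
  qed (use that(2) in simp)
  have "\<exists>n. \<beta> \<in> elts (vsucc (e n))" if \<beta>: "\<beta> \<in> elts \<alpha>" for \<beta>
  proof -
    obtain n where "\<beta> = a n" using \<beta> a by blast
    then show ?thesis using ae[of n] by (metis elts_vsucc insertI2)
  qed
  then obtain k where k: "\<And>\<beta>. \<beta> \<in> elts \<alpha> \<Longrightarrow> \<beta> \<in> elts (vsucc (e (k \<beta>)))" by metis
  define Q' where "Q' \<beta> = P (k \<beta>) \<beta>" for \<beta>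
  have e_sub: "\<beta> \<in> elts \<alpha>" if "\<beta> \<in> elts (vsucc (e n))" for \<beta> n
    using that e[of n] Ord_trans[OF ord e] by auto
  have Q': "Q' \<beta> = P n \<beta>" if "\<beta> \<in> elts (vsucc (e n))" for \<beta> n
    using agree[of n "max n (k \<beta>)" \<beta>] agree[of "k \<beta>" "max n (k \<beta>)" \<beta>] that k[OF e_sub[OF that]]
    unfolding Q'_def by simp
  have chain: "continuous_chain \<kappa> (vsucc (e n)) Q'" for n
  proof (rule continuous_chain_cong)
    show "Ord (vsucc (e n))" using Ord_elem[OF ord e] by (rule Ord_vsucc)
    show "P n \<beta> = Q' \<beta>" if "\<beta> \<in> elts (vsucc (e n))" for \<beta> using Q'[OF that] by simp
    show "continuous_chain \<kappa> (vsucc (e n)) (P n)" using ext unfolding chain_extension_def by blast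
  qed
  have "continuous_chain \<kappa> \<alpha> Q'" unfolding continuous_chain_def
  proof (intro conjI ballI impI)
    fix \<beta> assume \<beta>: "\<beta> \<in> elts \<alpha>"
    show "elts (Q' \<beta>) \<subseteq> H \<kappa>" "countable (elts (Q' \<beta>))"
      using chain k[OF \<beta>] unfolding continuous_chain_def by blast+
    show "elts (Q' \<beta>) = (\<Union>\<gamma>\<in>elts \<beta>. elts (Q' \<gamma>))" if "Limit \<beta>"
      using chain k[OF \<beta>] that unfolding continuous_chain_def by blast
    assume s: "vsucc \<beta> \<in> elts \<alpha>"
    let ?n = "k (vsucc \<beta>)"
    have o: "Ord (vsucc (e ?n))" using Ord_elem[OF ord e] by (rule Ord_vsucc)
    have "\<beta> \<in> elts (vsucc (e ?n))" using Ord_trans[OF o k[OF s]] by simp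
    then show "Q' \<beta> \<in> elts (Q' (vsucc \<beta>))"
      using chain[of ?n] k[OF s] unfolding continuous_chain_def by blast
  qed
  moreover have union: "elts N = (\<Union>\<beta>\<in>elts \<alpha>. elts (Q' \<beta>))"
  proof
    show "elts N \<subseteq> (\<Union>\<beta>\<in>elts \<alpha>. elts (Q' \<beta>))"
    proof
      fix y assume "y \<in> elts N"
      then obtain n where "y = x n" using x by blast
      then have "y \<in> elts (Q' (e (Suc n)))" using xP[of n] Q'[of "e (Suc n)" "Suc n"] by simp
      then show "y \<in> (\<Union>\<beta>\<in>elts \<alpha>. elts (Q' \<beta>))" using e by blast
    qed
    show "(\<Union>\<beta>\<in>elts \<alpha>. elts (Q' \<beta>)) \<subseteq> elts N"
    proof (rule UN_least)
      fix \<beta> assume \<beta>: "\<beta> \<in> elts \<alpha>"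
      let ?n = "k \<beta>"
      have "countable (elts (vsucc (e ?n)))" using e sub omega1_vsucc omega1_countable by blast
      then have "vpair \<beta> (P ?n \<beta>) \<in> elts N"
        using ctN[OF code[of ?n]] k[OF \<beta>] by (auto simp: elts_vseq)
      then have "{vset {\<beta>}, vset {\<beta>, P ?n \<beta>}} \<subseteq> elts N"
        using ctN[of "vpair \<beta> (P ?n \<beta>)"] by (simp add: vpair_def)
      then have "P ?n \<beta> \<in> elts N" using ctN[of "vset {\<beta>, P ?n \<beta>}"] by simp
      moreover have "countable (elts (P ?n \<beta>))"
        using ext[of ?n] k[OF \<beta>] unfolding chain_extension_def continuous_chain_def by blast
      ultimately show "elts (Q' \<beta>) \<subseteq> elts N" using ctN unfolding Q'_def by blast
    qed
  qed
  ultimately have top: "continuous_chain \<kappa> (vsucc \<alpha>) (Q'(\<alpha> := N))"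
    using continuous_chain_append[OF ord _ N(3,4)] \<alpha>(2) Limit_not_vsucc by metis
  have "chain_extension \<kappa> R \<delta> Q \<alpha> (Q'(\<alpha> := N))" unfolding chain_extension_def
  proof (intro conjI ballI)
    fix \<beta> assume b: "\<beta> \<in> elts (vsucc \<delta>)"
    then have be: "\<beta> \<in> elts (vsucc (e 0))" using \<delta>e by blast
    then have "\<beta> \<noteq> \<alpha>" using e_sub mem_irrefl by metis
    then show "(Q'(\<alpha> := N)) \<beta> = Q \<beta>"
      using Q'[OF be] ext[of 0] b unfolding chain_extension_def by auto
  next
    fix \<beta> assume b: "\<beta> \<in> elts (vsucc \<alpha>) - elts (vsucc \<delta>)"
    show "(Q'(\<alpha> := N)) \<beta> \<in> elts (R \<beta>)"
    proof (cases "\<beta> = \<alpha>")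
      case False
      then have "\<beta> \<in> elts (vsucc (e (k \<beta>)))" using b k by simp
      then have "P (k \<beta>) \<beta> \<in> elts (R \<beta>)" using ext[of "k \<beta>"] b unfolding chain_extension_def by blast
      then show ?thesis using False unfolding Q'_def by simp
    qed (use N(1) in simp)
  qed (rule top)
  then show ?thesis using cN by (intro exI[of _ "Q'(\<alpha> := N)"]) simp
qed

text \<open>
  Induction on \<open>\<alpha>\<close> for all starting chains at once, because the limit step extends many
  intermediate chains to smaller lengths.
\<close>

lemma chain_extension_exists:
  assumes \<kappa>: "uncountable_regular \<kappa>"
    and R: "\<And>\<beta>. \<beta> \<in> elts omega1 \<Longrightarrow> stationary_countable \<kappa> (R \<beta>)"
    and "\<alpha> \<in> elts omega1" "\<delta> \<in> elts \<alpha>" "continuous_chain \<kappa> (vsucc \<delta>) Q" "countable c" "c \<subseteq> H \<kappa>"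
  shows "\<exists>Q'. chain_extension \<kappa> R \<delta> Q \<alpha> Q' \<and> c \<subseteq> elts (Q' \<alpha>)"
  using assms(3-)
proof (induction \<alpha> arbitrary: \<delta> Q c rule: mem_induct)
  case (mem \<alpha>)
  note \<alpha> = mem.prems(1) and \<delta> = mem.prems(2) and Q = mem.prems(3) and c = mem.prems(4,5)
  have ord: "Ord \<alpha>" using \<alpha> by (rule omega1_Ord)
  from ord show ?case
  proof (cases rule: Ord_cases)
    case 1
    then show ?thesis using \<delta> by simp
  next
    case (2 \<beta>)
    have \<beta>: "\<beta> \<in> elts \<alpha>" "\<beta> \<in> elts omega1" using 2 omega1_trans[OF \<alpha>] by auto
    obtain Q1 where Q1: "chain_extension \<kappa> R \<delta> Q \<beta> Q1"
    proof (cases "\<delta> = \<beta>")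
      case True
      then have "chain_extension \<kappa> R \<delta> Q \<beta> Q" using Q unfolding chain_extension_def by simp
      then show ?thesis by (rule that)
    next
      case False
      then have "\<delta> \<in> elts \<beta>" using \<delta> 2 by simp
      then show ?thesis using mem.IH[OF \<beta>(1,2) _ Q, of "{}"] that by auto
    qed
    then have "continuous_chain \<kappa> (vsucc \<beta>) Q1" unfolding chain_extension_def by blast
    then obtain Q' where Q': "chain_extension \<kappa> R \<beta> Q1 \<alpha> Q'" "c \<subseteq> elts (Q' \<alpha>)"
      using chain_extension_successor[OF \<kappa> _ \<beta>(2) _ c, of R Q1] R[OF \<alpha>] unfolding 2 by blast
    have "elts (vsucc \<delta>) \<subseteq> elts (vsucc \<beta>)"
      using \<delta> Ord_trans[OF ord \<delta>] unfolding 2 by auto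
    then show ?thesis using chain_extension_trans[OF Q1 Q'(1)] Q'(2) by blast
  next
    case 3
    show ?thesis
    proof (rule chain_extension_limit[where R = R, OF \<kappa> R[OF \<alpha>] \<alpha> 3 \<delta> Q c])
      fix \<epsilon> \<zeta> P x
      assume *: "\<zeta> \<in> elts \<alpha>" "\<epsilon> \<in> elts \<zeta>" "continuous_chain \<kappa> (vsucc \<epsilon>) P" "x \<in> H \<kappa>"
      show "\<exists>Q'. chain_extension \<kappa> R \<epsilon> P \<zeta> Q' \<and> x \<in> elts (Q' \<zeta>)"
        using mem.IH[OF *(1) omega1_trans[OF \<alpha> *(1)] *(2,3), of "{x}"] *(4) by auto
    qed
  qed
qed

section \<open>Closure under a function of finite sets\<close>

text \<open>Closing off in \<open>\<omega>\<close> steps, which makes it evident that closures of countable sets are countable.\<close>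

definition fun_closure :: "('a set \<Rightarrow> 'a) \<Rightarrow> 'a set \<Rightarrow> 'a set" where
  "fun_closure F A = (\<Union>n. ((\<lambda>B. B \<union> F ` Fpow B) ^^ n) A)"

lemma subset_fun_closure: "A \<subseteq> fun_closure F A"
  unfolding fun_closure_def by (rule subsetI, rule UN_I[of 0]) simp_all

lemma fun_closure_closed:
  assumes "finite e" "e \<subseteq> fun_closure F A" shows "F e \<in> fun_closure F A"
proof -
  define U where "U n = ((\<lambda>B. B \<union> F ` Fpow B) ^^ n) A" for n :: nat
  have US: "U (Suc n) = U n \<union> F ` Fpow (U n)" for n by (simp add: U_def)
  have mono: "U m \<subseteq> U n" if "m \<le> n" for m n
    using that by (rule lift_Suc_mono_le[rotated]) (use US in blast)
  have cl: "fun_closure F A = (\<Union>n. U n)" unfolding fun_closure_def U_def ..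
  from assms have "\<exists>n. e \<subseteq> U n" unfolding cl
  proof (induction e)
    case (insert y e)
    then obtain m n where "y \<in> U m" "e \<subseteq> U n" by auto
    then have "insert y e \<subseteq> U (max m n)" using mono[of m "max m n"] mono[of n "max m n"] by auto
    then show ?case by blast
  qed simp
  then obtain n where "e \<in> Fpow (U n)" using assms(1) unfolding Fpow_def by blast
  then have "F e \<in> U (Suc n)" unfolding US by blast
  then show ?thesis unfolding cl by blast
qed

lemma fun_closure_least:
  assumes "A \<subseteq> B" "\<And>e. finite e \<Longrightarrow> e \<subseteq> B \<Longrightarrow> F e \<in> B" shows "fun_closure F A \<subseteq> B"
proof -
  have "((\<lambda>B. B \<union> F ` Fpow B) ^^ n) A \<subseteq> B" for n
    by (induction n) (use assms in \<open>auto simp: Fpow_def\<close>)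
  then show ?thesis unfolding fun_closure_def by blast
qed

lemma fun_closure_mono: "A \<subseteq> B \<Longrightarrow> fun_closure F A \<subseteq> fun_closure F B"
  using subset_fun_closure[of B F] by (intro fun_closure_least fun_closure_closed) auto

lemma countable_fun_closure:
  assumes "countable A" shows "countable (fun_closure F A)"
proof -
  have "countable (((\<lambda>B. B \<union> F ` Fpow B) ^^ n) A)" for n
    by (induction n) (use assms countable_Fpow in auto)
  then show ?thesis unfolding fun_closure_def by simp
qed

section \<open>Density\<close>

text \<open>
  The members of \<^const>\<open>DSRP_conditions\<close> and their order, with the sequences as functions instead of
  their codes.
\<close>

definition DSRP_condition ::
  "'v::zfc_universe \<Rightarrow> 'v set \<Rightarrow> ('v \<Rightarrow> 'v set) \<Rightarrow> 'v \<Rightarrow> 'v \<Rightarrow> ('v \<Rightarrow> 'v) \<Rightarrow> ('v \<Rightarrow> 'v) \<Rightarrow> bool" where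
  "DSRP_condition \<kappa> \<S> T \<delta> \<nu> Q S \<longleftrightarrow>
     \<delta> \<in> elts omega1 \<and> \<nu> \<in> elts omega1 \<and> continuous_chain \<kappa> (vsucc \<delta>) Q \<and> (\<forall>i\<in>elts \<nu>. S i \<in> \<S>) \<and>
     (\<forall>\<alpha>\<in>elts (vsucc \<delta>). \<forall>i\<in>elts omega1. \<alpha> \<in> T i \<longrightarrow> i \<in> elts \<nu> \<and> Q \<alpha> \<in> elts (S i))"

definition extends ::
  "'v::zfc_universe \<Rightarrow> 'v \<Rightarrow> ('v \<Rightarrow> 'v) \<Rightarrow> ('v \<Rightarrow> 'v) \<Rightarrow> 'v \<Rightarrow> 'v \<Rightarrow> ('v \<Rightarrow> 'v) \<Rightarrow> ('v \<Rightarrow> 'v) \<Rightarrow> bool" where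
  "extends \<delta>' \<nu>' Q' S' \<delta> \<nu> Q S \<longleftrightarrow>
     elts (vsucc \<delta>) \<subseteq> elts (vsucc \<delta>') \<and> (\<forall>\<beta>\<in>elts (vsucc \<delta>). Q' \<beta> = Q \<beta>) \<and>
     elts \<nu> \<subseteq> elts \<nu>' \<and> (\<forall>i\<in>elts \<nu>. S' i = S i)"

lemma extends_trans:
  assumes "extends \<delta>2 \<nu>2 Q2 S2 \<delta>1 \<nu>1 Q1 S1" "extends \<delta>1 \<nu>1 Q1 S1 \<delta> \<nu> Q S"
  shows "extends \<delta>2 \<nu>2 Q2 S2 \<delta> \<nu> Q S"
  unfolding extends_def
proof (intro conjI ballI)
  show "elts (vsucc \<delta>) \<subseteq> elts (vsucc \<delta>2)" "elts \<nu> \<subseteq> elts \<nu>2"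
    using assms unfolding extends_def by (meson subset_trans)+
  show "Q2 \<beta> = Q \<beta>" if "\<beta> \<in> elts (vsucc \<delta>)" for \<beta>
    using assms that unfolding extends_def by (metis subsetD)
  show "S2 i = S i" if "i \<in> elts \<nu>" for i
    using assms that unfolding extends_def by (metis subsetD)
qed

lemma DSRP_conditions_iff:
  "p \<in> DSRP_conditions \<kappa> \<S> T \<longleftrightarrow>
     (\<exists>\<delta> \<nu> Q S. p = vpair (vseq (vsucc \<delta>) Q) (vseq \<nu> S) \<and> DSRP_condition \<kappa> \<S> T \<delta> \<nu> Q S)"
  unfolding DSRP_conditions_def DSRP_condition_def by blast

lemma DSRP_forcing_order_iff:
  "(vpair (vseq (vsucc \<delta>') Q') (vseq \<nu>' S'), vpair (vseq (vsucc \<delta>) Q) (vseq \<nu> S))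
      \<in> snd (DSRP_forcing \<kappa> \<S> T) \<longleftrightarrow>
    vpair (vseq (vsucc \<delta>') Q') (vseq \<nu>' S') \<in> DSRP_conditions \<kappa> \<S> T \<and>
    vpair (vseq (vsucc \<delta>) Q) (vseq \<nu> S) \<in> DSRP_conditions \<kappa> \<S> T \<and>
    extends \<delta>' \<nu>' Q' S' \<delta> \<nu> Q S"
proof -
  have "(vpair a b, vpair c d) \<in> snd (DSRP_forcing \<kappa> \<S> T) \<longleftrightarrow>
      vpair a b \<in> DSRP_conditions \<kappa> \<S> T \<and> vpair c d \<in> DSRP_conditions \<kappa> \<S> T \<and>
      elts c \<subseteq> elts a \<and> elts d \<subseteq> elts b" for a b c d
    unfolding DSRP_forcing_def by auto
  moreover have "extends \<delta>' \<nu>' Q' S' \<delta> \<nu> Q S \<longleftrightarrow>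
      elts (vseq (vsucc \<delta>) Q) \<subseteq> elts (vseq (vsucc \<delta>') Q') \<and> elts (vseq \<nu> S) \<subseteq> elts (vseq \<nu>' S')"
    unfolding vseq_subset_iff extends_def by (metis (no_types, lifting))
  ultimately show ?thesis by (simp only:)
qed

text \<open>
  By disjointness every \<open>\<beta>\<close> lies in at most one \<open>T i\<close>, so the countably many \<open>\<beta> \<le> \<alpha>\<close> involve only
  countably many \<open>i\<close>. All their labels can be chosen before a chain is extended to length \<open>\<alpha>\<close>.
\<close>

lemma countable_relevant_indices:
  assumes T: "disjoint_family_on T (elts omega1)" and \<alpha>: "\<alpha> \<in> elts omega1"
  shows "\<exists>\<rho>\<in>elts omega1. \<forall>\<beta>\<in>elts (vsucc \<alpha>). \<forall>i\<in>elts omega1. \<beta> \<in> T i \<longrightarrow> i \<in> elts \<rho>"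
proof -
  define I where "I \<beta> = {i \<in> elts omega1. \<beta> \<in> T i}" for \<beta>
  have "countable (I \<beta>)" for \<beta>
  proof (cases "I \<beta> = {}")
    case False
    then obtain i where i: "i \<in> I \<beta>" by blast
    have "I \<beta> \<subseteq> {i}"
      using T i unfolding I_def disjoint_family_on_def by blast
    then show ?thesis using countable_subset by blast
  qed simp
  then have "countable (\<Union>\<beta>\<in>elts (vsucc \<alpha>). I \<beta>)"
    using omega1_countable[OF omega1_vsucc[OF \<alpha>]] by (intro countable_UN)
  moreover have "(\<Union>\<beta>\<in>elts (vsucc \<alpha>). I \<beta>) \<subseteq> elts omega1" unfolding I_def by blast
  ultimately obtain \<rho> where "\<rho> \<in> elts omega1" "(\<Union>\<beta>\<in>elts (vsucc \<alpha>). I \<beta>) \<subseteq> elts \<rho>"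
    using countable_bounded_omega1 by blast
  then show ?thesis unfolding I_def by blast
qed

text \<open>
  Longer label sequences never violate a condition. An infinite set \<open>range f\<close> of unused positions
  provides room for all of \<open>d\<close>.
\<close>

lemma extend_labels:
  assumes p: "DSRP_condition \<kappa> \<S> T \<delta> \<nu> Q S" and "\<S> \<noteq> {}" and \<rho>: "\<rho> \<in> elts omega1"
    and d: "countable d" "d \<subseteq> \<S>"
  shows "\<exists>\<nu>' S'. DSRP_condition \<kappa> \<S> T \<delta> \<nu>' Q S' \<and> extends \<delta> \<nu>' Q S' \<delta> \<nu> Q S \<and>
    elts \<rho> \<subseteq> elts \<nu>' \<and> d \<subseteq> S' ` elts \<nu>'"
proof -
  obtain s where s: "s \<in> \<S>" using assms(2) by blast
  define h where "h = from_nat_into (insert s d)"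
  have h: "range h = insert s d" unfolding h_def using d(1) by (intro range_from_nat_into) auto
  have \<nu>: "\<nu> \<in> elts omega1" using p unfolding DSRP_condition_def by blast
  have "uncountable (elts omega1 - elts \<nu>)"
    by (rule uncountable_minus_countable[OF uncountable_omega1 omega1_countable[OF \<nu>]])
  then have "infinite (elts omega1 - elts \<nu>)" using countable_finite by blast
  then obtain f :: "nat \<Rightarrow> 'a" where f: "inj f" "range f \<subseteq> elts omega1 - elts \<nu>"
    using infinite_countable_subset by blast
  define S' where "S' i = (if i \<in> elts \<nu> then S i else h (inv f i))" for i
  have 1: "countable (elts \<nu> \<union> elts \<rho> \<union> range f)"
    using omega1_countable[OF \<nu>] omega1_countable[OF \<rho>] by simp
  have 2: "elts \<nu> \<union> elts \<rho> \<union> range f \<subseteq> elts omega1"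
    using omega1_trans[OF \<nu>] omega1_trans[OF \<rho>] f(2) by blast
  from countable_bounded_omega1[OF 1 2] obtain \<nu>'
    where \<nu>': "\<nu>' \<in> elts omega1" "elts \<nu> \<union> elts \<rho> \<union> range f \<subseteq> elts \<nu>'" by (rule bexE)
  have old: "S' i = S i" if "i \<in> elts \<nu>" for i using that unfolding S'_def by simp
  have "h n \<in> \<S>" for n
  proof -
    have "h n \<in> insert s d" unfolding h[symmetric] by (rule rangeI)
    then show ?thesis using s d(2) by blast
  qed
  then have S': "S' i \<in> \<S>" for i using p unfolding S'_def DSRP_condition_def by simp
  have "DSRP_condition \<kappa> \<S> T \<delta> \<nu>' Q S'"
    unfolding DSRP_condition_def
  proof (intro conjI ballI impI)
    fix \<alpha> i assume "\<alpha> \<in> elts (vsucc \<delta>)" "i \<in> elts omega1" "\<alpha> \<in> T i"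
    then have "i \<in> elts \<nu>" "Q \<alpha> \<in> elts (S i)" using p unfolding DSRP_condition_def by blast+
    then show "i \<in> elts \<nu>'" "Q \<alpha> \<in> elts (S' i)" using \<nu>'(2) old by auto
  qed (use p \<nu>'(1) S' in \<open>auto simp: DSRP_condition_def\<close>)
  moreover have "extends \<delta> \<nu>' Q S' \<delta> \<nu> Q S" unfolding extends_def using \<nu>'(2) old by blast
  moreover have "d \<subseteq> S' ` elts \<nu>'"
  proof
    fix x assume "x \<in> d"
    then have "x \<in> range h" unfolding h by blast
    then obtain n where n: "x = h n" by blast
    have "S' (f n) = x" unfolding S'_def n using f by (auto simp: inv_f_f)
    then show "x \<in> S' ` elts \<nu>'" using \<nu>'(2) by blast
  qed
  ultimately show ?thesis using \<nu>'(2) by blast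
qed

lemma extend_condition_chain:
  assumes \<kappa>: "uncountable_regular \<kappa>" and stat: "\<forall>S\<in>\<S>. stationary_countable \<kappa> S"
    and T: "disjoint_family_on T (elts omega1)"
    and p: "DSRP_condition \<kappa> \<S> T \<delta> \<nu> Q S" and "\<S> \<noteq> {}"
    and \<alpha>: "\<alpha> \<in> elts omega1" "\<delta> \<in> elts \<alpha>"
    and idx: "\<forall>\<beta>\<in>elts (vsucc \<alpha>). \<forall>i\<in>elts omega1. \<beta> \<in> T i \<longrightarrow> i \<in> elts \<nu>"
    and c: "countable c" "c \<subseteq> H \<kappa>"
  shows "\<exists>Q'. DSRP_condition \<kappa> \<S> T \<alpha> \<nu> Q' S \<and> extends \<alpha> \<nu> Q' S \<delta> \<nu> Q S \<and> c \<subseteq> elts (Q' \<alpha>)"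
proof -
  obtain s where s: "s \<in> \<S>" using assms(5) by blast
  have \<nu>: "\<nu> \<in> elts omega1" and Q: "continuous_chain \<kappa> (vsucc \<delta>) Q"
    and S: "\<And>i. i \<in> elts \<nu> \<Longrightarrow> S i \<in> \<S>" using p unfolding DSRP_condition_def by blast+
  \<comment> \<open>Positions outside all \<open>T i\<close> carry no constraint; the default \<open>s\<close> only keeps \<open>R \<beta>\<close> stationary.\<close>
  define R where "R \<beta> = (if \<exists>i\<in>elts \<nu>. \<beta> \<in> T i then S (SOME i. i \<in> elts \<nu> \<and> \<beta> \<in> T i) else s)" for \<beta>
  have some: "(SOME i. i \<in> elts \<nu> \<and> \<beta> \<in> T i) = i" if "i \<in> elts \<nu>" "\<beta> \<in> T i" for \<beta> i
  proof (rule some_equality)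
    fix j assume "j \<in> elts \<nu> \<and> \<beta> \<in> T j"
    then show "j = i" using that T omega1_trans[OF \<nu>] unfolding disjoint_family_on_def by blast
  qed (use that in blast)
  have R: "R \<beta> = S i" if "i \<in> elts \<nu>" "\<beta> \<in> T i" for \<beta> i
    unfolding R_def using that some[OF that] by auto
  have "R \<beta> \<in> \<S>" for \<beta>
  proof (cases "\<exists>i\<in>elts \<nu>. \<beta> \<in> T i")
    case True
    then show ?thesis using R S by metis
  next
    case False
    then have "R \<beta> = s" unfolding R_def by (rule if_not_P)
    then show ?thesis using s by simp
  qed
  then have "stationary_countable \<kappa> (R \<beta>)" for \<beta> using stat by blast
  from chain_extension_exists[where R = R, OF \<kappa> this \<alpha> Q c]
  obtain Q' where Q': "chain_extension \<kappa> R \<delta> Q \<alpha> Q'" "c \<subseteq> elts (Q' \<alpha>)" by blast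
  have old: "Q' \<beta> = Q \<beta>" if "\<beta> \<in> elts (vsucc \<delta>)" for \<beta>
    using Q'(1) that unfolding chain_extension_def by blast
  have "DSRP_condition \<kappa> \<S> T \<alpha> \<nu> Q' S" unfolding DSRP_condition_def
  proof (intro conjI ballI impI)
    fix \<beta> i assume b: "\<beta> \<in> elts (vsucc \<alpha>)" "i \<in> elts omega1" "\<beta> \<in> T i"
    then show i: "i \<in> elts \<nu>" using idx by blast
    show "Q' \<beta> \<in> elts (S i)"
    proof (cases "\<beta> \<in> elts (vsucc \<delta>)")
      case True
      then have "Q \<beta> \<in> elts (S i)" using p b unfolding DSRP_condition_def by blast
      then show ?thesis using old[OF True] by simp
    next
      case False
      then have "Q' \<beta> \<in> elts (R \<beta>)" using Q'(1) b(1) unfolding chain_extension_def by blast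
      then show ?thesis using R[OF i b(3)] by simp
    qed
  qed (use \<alpha> \<nu> S Q'(1) in \<open>auto simp: chain_extension_def\<close>)
  moreover have "extends \<alpha> \<nu> Q' S \<delta> \<nu> Q S"
    unfolding extends_def using old \<alpha>(2) Ord_trans[OF omega1_Ord[OF \<alpha>(1)] \<alpha>(2)] by auto
  ultimately show ?thesis using Q'(2) by blast
qed

text \<open>
  First the labels are extended, far enough to decide every constraint up to the new length, and then
  the chain is extended against these labels.
\<close>

lemma extend_condition:
  assumes \<kappa>: "uncountable_regular \<kappa>" and stat: "\<forall>S\<in>\<S>. stationary_countable \<kappa> S"
    and T: "disjoint_family_on T (elts omega1)" and ne: "\<S> \<noteq> {}"
    and p: "DSRP_condition \<kappa> \<S> T \<delta> \<nu> Q S"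
    and \<alpha>: "\<alpha> \<in> elts omega1" and c: "countable c" "c \<subseteq> H \<kappa>" and d: "countable d" "d \<subseteq> \<S>"
  shows "\<exists>\<delta>' \<nu>' Q' S'. DSRP_condition \<kappa> \<S> T \<delta>' \<nu>' Q' S' \<and> extends \<delta>' \<nu>' Q' S' \<delta> \<nu> Q S \<and>
    \<alpha> \<in> elts (vsucc \<delta>') \<and> \<alpha> \<in> elts \<nu>' \<and>
    c \<subseteq> (\<Union>\<beta>\<in>elts (vsucc \<delta>'). elts (Q' \<beta>)) \<and> d \<subseteq> S' ` elts \<nu>'"
proof -
  have \<delta>: "\<delta> \<in> elts omega1" using p unfolding DSRP_condition_def by blast
  obtain \<delta>' where \<delta>': "\<delta>' \<in> elts omega1" "\<alpha> \<in> elts \<delta>'" "\<delta> \<in> elts \<delta>'"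
    using countable_bounded_omega1[of "{\<alpha>, \<delta>}"] \<alpha> \<delta> by auto
  obtain \<rho> where \<rho>: "\<rho> \<in> elts omega1"
    "\<forall>\<beta>\<in>elts (vsucc \<delta>'). \<forall>i\<in>elts omega1. \<beta> \<in> T i \<longrightarrow> i \<in> elts \<rho>"
    using countable_relevant_indices[OF T \<delta>'(1)] by (rule bexE)
  obtain \<rho>' where \<rho>': "\<rho>' \<in> elts omega1" "\<alpha> \<in> elts \<rho>'" "\<rho> \<in> elts \<rho>'"
    using countable_bounded_omega1[of "{\<alpha>, \<rho>}"] \<alpha> \<rho>(1) by auto
  have \<rho>\<rho>: "elts \<rho> \<subseteq> elts \<rho>'" using Ord_trans[OF omega1_Ord[OF \<rho>'(1)] \<rho>'(3)] by blast
  from extend_labels[OF p ne \<rho>'(1) d] obtain \<nu>' S' where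
    1: "DSRP_condition \<kappa> \<S> T \<delta> \<nu>' Q S'" "extends \<delta> \<nu>' Q S' \<delta> \<nu> Q S"
      "elts \<rho>' \<subseteq> elts \<nu>'" "d \<subseteq> S' ` elts \<nu>'" by blast
  have idx: "\<forall>\<beta>\<in>elts (vsucc \<delta>'). \<forall>i\<in>elts omega1. \<beta> \<in> T i \<longrightarrow> i \<in> elts \<nu>'"
    using \<rho>(2) \<rho>\<rho> 1(3) by blast
  from extend_condition_chain[OF \<kappa> stat T 1(1) ne \<delta>'(1,3) idx c] obtain Q' where
    2: "DSRP_condition \<kappa> \<S> T \<delta>' \<nu>' Q' S'" "extends \<delta>' \<nu>' Q' S' \<delta> \<nu>' Q S'" "c \<subseteq> elts (Q' \<delta>')"
    by blast
  have "c \<subseteq> (\<Union>\<beta>\<in>elts (vsucc \<delta>'). elts (Q' \<beta>))" using 2(3) by auto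
  moreover have "\<alpha> \<in> elts (vsucc \<delta>')" "\<alpha> \<in> elts \<nu>'" using \<delta>'(2) \<rho>'(2) 1(3) by auto
  ultimately show ?thesis using 2(1) extends_trans[OF 2(2) 1(2)] 1(4) by blast
qed

text \<open>
  The generators contributed up to \<open>\<alpha>\<close> to the reflecting set: members of the \<open>Q \<beta>\<close>, labels, ordinals
  and codes of initial segments of the chain. They depend only on the values of \<open>Q\<close> and \<open>S\<close> up to
  \<open>\<alpha>\<close>, so a condition that reaches \<open>\<alpha>\<close> determines them once and for all.
\<close>

definition stage :: "'v::zfc_universe \<Rightarrow> ('v \<Rightarrow> 'v) \<Rightarrow> ('v \<Rightarrow> 'v) \<Rightarrow> 'v set" where
  "stage \<alpha> Q S = (\<Union>\<beta>\<in>elts (vsucc \<alpha>). elts (Q \<beta>)) \<union> S ` elts (vsucc \<alpha>) \<union>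
     elts (vsucc \<alpha>) \<union> (\<lambda>\<beta>. vseq \<beta> Q) ` elts (vsucc \<alpha>)"

lemma stage_cong:
  assumes "Ord \<alpha>" "\<And>\<beta>. \<beta> \<in> elts (vsucc \<alpha>) \<Longrightarrow> Q \<beta> = Q' \<beta>" "\<And>\<beta>. \<beta> \<in> elts (vsucc \<alpha>) \<Longrightarrow> S \<beta> = S' \<beta>"
  shows "stage \<alpha> Q S = stage \<alpha> Q' S'"
proof -
  have "vseq \<beta> Q = vseq \<beta> Q'" if "\<beta> \<in> elts (vsucc \<alpha>)" for \<beta>
    unfolding vseq_eq_iff using assms(2) Ord_trans[OF Ord_vsucc[OF assms(1)] that] by blast
  then have "(\<lambda>\<beta>. vseq \<beta> Q) ` elts (vsucc \<alpha>) = (\<lambda>\<beta>. vseq \<beta> Q') ` elts (vsucc \<alpha>)"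
    by (rule image_cong[OF refl])
  moreover have "(\<Union>\<beta>\<in>elts (vsucc \<alpha>). elts (Q \<beta>)) = (\<Union>\<beta>\<in>elts (vsucc \<alpha>). elts (Q' \<beta>))"
    using assms(2) by (intro SUP_cong refl) simp
  moreover have "S ` elts (vsucc \<alpha>) = S' ` elts (vsucc \<alpha>)" using assms(3) by (rule image_cong[OF refl])
  ultimately show ?thesis unfolding stage_def by (simp only:)
qed

text \<open>
  Conditions that have captured whatever the closure of \<open>stage \<alpha>\<close> adds to \<open>H \<kappa>\<close> and to \<open>\<S>\<close>.
\<close>

definition closing_conditions ::
  "'v::zfc_universe \<Rightarrow> 'v set \<Rightarrow> ('v \<Rightarrow> 'v set) \<Rightarrow> ('v set \<Rightarrow> 'v) \<Rightarrow> 'v \<Rightarrow> 'v set" where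
  "closing_conditions \<kappa> \<S> T F \<alpha> = {vpair (vseq (vsucc \<delta>) Q) (vseq \<nu> S) | \<delta> \<nu> Q S.
     DSRP_condition \<kappa> \<S> T \<delta> \<nu> Q S \<and> \<alpha> \<in> elts (vsucc \<delta>) \<and> \<alpha> \<in> elts \<nu> \<and>
     fun_closure F (stage \<alpha> Q S) \<inter> H \<kappa> \<subseteq> (\<Union>\<beta>\<in>elts (vsucc \<delta>). elts (Q \<beta>)) \<and>
     fun_closure F (stage \<alpha> Q S) \<inter> \<S> \<subseteq> S ` elts \<nu>}"

text \<open>
  A first extension reaches \<open>\<alpha>\<close> and thereby fixes the countable closure \<open>C\<close> of \<open>stage \<alpha>\<close>; a second one
  absorbs \<open>C \<inter> H \<kappa>\<close> into its chain and \<open>C \<inter> \<S>\<close> into its labels without changing \<open>C\<close>.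
\<close>

lemma dense_closing_conditions:
  assumes \<kappa>: "uncountable_regular \<kappa>" and stat: "\<forall>S\<in>\<S>. stationary_countable \<kappa> S"
    and T: "disjoint_family_on T (elts omega1)" and ne: "\<S> \<noteq> {}" and \<alpha>: "\<alpha> \<in> elts omega1"
  shows "dense_in (DSRP_forcing \<kappa> \<S> T) (closing_conditions \<kappa> \<S> T F \<alpha>)"
proof -
  have "closing_conditions \<kappa> \<S> T F \<alpha> \<subseteq> DSRP_conditions \<kappa> \<S> T"
    unfolding closing_conditions_def DSRP_conditions_iff subset_iff by blast
  moreover have "\<exists>q\<in>closing_conditions \<kappa> \<S> T F \<alpha>. (q, p) \<in> snd (DSRP_forcing \<kappa> \<S> T)"
    if p: "p \<in> DSRP_conditions \<kappa> \<S> T" for p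
  proof -
    from p obtain \<delta> \<nu> Q S where
      0: "p = vpair (vseq (vsucc \<delta>) Q) (vseq \<nu> S)" "DSRP_condition \<kappa> \<S> T \<delta> \<nu> Q S"
      unfolding DSRP_conditions_iff by blast
    from extend_condition[OF \<kappa> stat T ne 0(2) \<alpha> countable_empty empty_subsetI countable_empty empty_subsetI] obtain \<delta>1 \<nu>1 Q1 S1 where
      1: "DSRP_condition \<kappa> \<S> T \<delta>1 \<nu>1 Q1 S1" "extends \<delta>1 \<nu>1 Q1 S1 \<delta> \<nu> Q S"
        "\<alpha> \<in> elts (vsucc \<delta>1)" "\<alpha> \<in> elts \<nu>1" by (elim exE conjE) (rule that)
    define C where "C = fun_closure F (stage \<alpha> Q1 S1)"
    have \<delta>1: "\<delta>1 \<in> elts omega1" "\<nu>1 \<in> elts omega1" using 1(1) unfolding DSRP_condition_def by blast+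
    have sub: "elts (vsucc \<alpha>) \<subseteq> elts (vsucc \<delta>1)" "elts (vsucc \<alpha>) \<subseteq> elts \<nu>1"
      using 1(3,4) Ord_trans[OF omega1_Ord[OF omega1_vsucc[OF \<delta>1(1)]] 1(3)]
        Ord_trans[OF omega1_Ord[OF \<delta>1(2)] 1(4)] by auto
    have chain: "continuous_chain \<kappa> (vsucc \<delta>1) Q1" using 1(1) unfolding DSRP_condition_def by blast
    have "countable (elts (Q1 \<beta>))" if "\<beta> \<in> elts (vsucc \<alpha>)" for \<beta>
      using chain subsetD[OF sub(1) that] unfolding continuous_chain_def by blast
    then have "countable (stage \<alpha> Q1 S1)"
      unfolding stage_def using omega1_countable[OF omega1_vsucc[OF \<alpha>]]
      by (intro countable_Un countable_UN countable_image)
    then have C: "countable C" unfolding C_def by (rule countable_fun_closure)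
    have C': "countable (C \<inter> H \<kappa>)" "C \<inter> H \<kappa> \<subseteq> H \<kappa>" "countable (C \<inter> \<S>)" "C \<inter> \<S> \<subseteq> \<S>"
      using C by (auto intro: countable_subset)
    from extend_condition[OF \<kappa> stat T ne 1(1) \<alpha> C'] obtain \<delta>2 \<nu>2 Q2 S2 where
      2: "DSRP_condition \<kappa> \<S> T \<delta>2 \<nu>2 Q2 S2" "extends \<delta>2 \<nu>2 Q2 S2 \<delta>1 \<nu>1 Q1 S1"
        "\<alpha> \<in> elts (vsucc \<delta>2)" "\<alpha> \<in> elts \<nu>2"
        "C \<inter> H \<kappa> \<subseteq> (\<Union>\<beta>\<in>elts (vsucc \<delta>2). elts (Q2 \<beta>))" "C \<inter> \<S> \<subseteq> S2 ` elts \<nu>2"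
      by (elim exE conjE) (rule that)
    have "stage \<alpha> Q2 S2 = stage \<alpha> Q1 S1"
      by (rule stage_cong[OF omega1_Ord[OF \<alpha>]]) (use 2(2) sub in \<open>auto simp only: extends_def\<close>)
    then have "fun_closure F (stage \<alpha> Q2 S2) = C" unfolding C_def by simp
    then have q: "vpair (vseq (vsucc \<delta>2) Q2) (vseq \<nu>2 S2) \<in> closing_conditions \<kappa> \<S> T F \<alpha>"
      unfolding closing_conditions_def using 2 by blast
    have "(vpair (vseq (vsucc \<delta>2) Q2) (vseq \<nu>2 S2), p) \<in> snd (DSRP_forcing \<kappa> \<S> T)"
      unfolding 0(1) DSRP_forcing_order_iff DSRP_conditions_iff
      using 0(2) 2(1) extends_trans[OF 2(2) 1(2)] by blast
    then show ?thesis using q by blast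
  qed
  ultimately show ?thesis unfolding dense_in_def by (simp add: DSRP_forcing_def)
qed

section \<open>The forcing axiom implies reflection\<close>

text \<open>Two members of a filter have a common extension, with which both agree.\<close>

lemma filter_conditions_agree:
  assumes G: "filter_on (DSRP_forcing \<kappa> \<S> T) G"
    and p: "vpair (vseq (vsucc \<delta>1) Q1) (vseq \<nu>1 S1) \<in> G"
    and q: "vpair (vseq (vsucc \<delta>2) Q2) (vseq \<nu>2 S2) \<in> G"
  shows "\<beta> \<in> elts (vsucc \<delta>1) \<Longrightarrow> \<beta> \<in> elts (vsucc \<delta>2) \<Longrightarrow> Q1 \<beta> = Q2 \<beta>"
    and "i \<in> elts \<nu>1 \<Longrightarrow> i \<in> elts \<nu>2 \<Longrightarrow> S1 i = S2 i"
proof -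
  let ?r = "snd (DSRP_forcing \<kappa> \<S> T)"
  have sub: "G \<subseteq> DSRP_conditions \<kappa> \<S> T"
    and dir: "\<forall>p\<in>G. \<forall>q\<in>G. \<exists>s\<in>G. (s, p) \<in> ?r \<and> (s, q) \<in> ?r"
    using G unfolding filter_on_def DSRP_forcing_def by auto
  from bspec[OF bspec[OF dir p] q] obtain s where s: "s \<in> G"
    "(s, vpair (vseq (vsucc \<delta>1) Q1) (vseq \<nu>1 S1)) \<in> ?r"
    "(s, vpair (vseq (vsucc \<delta>2) Q2) (vseq \<nu>2 S2)) \<in> ?r" by blast
  from s(1) sub obtain \<delta> \<nu> Q S where eq: "s = vpair (vseq (vsucc \<delta>) Q) (vseq \<nu> S)"
    unfolding DSRP_conditions_iff subset_iff by blast
  have e: "extends \<delta> \<nu> Q S \<delta>1 \<nu>1 Q1 S1" "extends \<delta> \<nu> Q S \<delta>2 \<nu>2 Q2 S2"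
    using s(2,3) unfolding eq DSRP_forcing_order_iff by blast+
  show "Q1 \<beta> = Q2 \<beta>" if "\<beta> \<in> elts (vsucc \<delta>1)" "\<beta> \<in> elts (vsucc \<delta>2)"
    using e that unfolding extends_def by metis
  show "S1 i = S2 i" if "i \<in> elts \<nu>1" "i \<in> elts \<nu>2"
    using e that unfolding extends_def by metis
qed

text \<open>
  The conditions in the filter glue to sequences \<open>Q\<close> and \<open>S\<close> of length \<open>omega1\<close>. The reflecting set is
  the increasing union of the closures of the stages. It is closed under \<open>F\<close> because every finite
  subset appears at some stage, and by genericity the closures add nothing to \<open>H \<kappa>\<close> beyond the
  \<open>Q \<alpha>\<close> and nothing to \<open>\<S>\<close> beyond the \<open>S i\<close>. Since ordinals and initial segments of the chain
  are among the generators, they end up in the reflecting set too.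
\<close>

lemma diagonal_chain_of_filter:
  fixes \<kappa> :: "'v::zfc_universe"
  assumes \<kappa>: "uncountable_regular \<kappa>" and \<theta>: "H \<kappa> \<prec> elts \<theta>"
    and stat: "\<forall>S\<in>\<S>. stationary_countable \<kappa> S"
    and F: "\<forall>x. finite x \<and> x \<subseteq> H \<theta> \<longrightarrow> F x \<in> H \<theta>"
    and G: "filter_on (DSRP_forcing \<kappa> \<S> T) G"
    and meets: "\<forall>\<alpha>\<in>elts omega1. G \<inter> closing_conditions \<kappa> \<S> T F \<alpha> \<noteq> {}"
  shows "\<exists>X Q S. X \<subseteq> H \<theta> \<and> X \<approx> elts (omega1 :: 'v) \<and> elts omega1 \<subseteq> X \<and>
    diagonal_chain \<kappa> \<S> T X Q S \<and> (\<forall>x. finite x \<and> x \<subseteq> X \<longrightarrow> F x \<in> X)"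
proof -
  have "\<forall>\<alpha>\<in>elts omega1. \<exists>\<delta> \<nu> Q S. vpair (vseq (vsucc \<delta>) Q) (vseq \<nu> S) \<in> G \<and>
      DSRP_condition \<kappa> \<S> T \<delta> \<nu> Q S \<and> \<alpha> \<in> elts (vsucc \<delta>) \<and> \<alpha> \<in> elts \<nu> \<and>
      fun_closure F (stage \<alpha> Q S) \<inter> H \<kappa> \<subseteq> (\<Union>\<beta>\<in>elts (vsucc \<delta>). elts (Q \<beta>)) \<and>
      fun_closure F (stage \<alpha> Q S) \<inter> \<S> \<subseteq> S ` elts \<nu>"
    (is "\<forall>\<alpha>\<in>_. \<exists>\<delta> \<nu> Q S. ?good \<alpha> \<delta> \<nu> Q S")
  proof
    fix \<alpha> :: 'v assume "\<alpha> \<in> elts omega1"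
    then obtain p where p: "p \<in> G" "p \<in> closing_conditions \<kappa> \<S> T F \<alpha>" using meets by blast
    from p(2) obtain \<delta> \<nu> Q S where "p = vpair (vseq (vsucc \<delta>) Q) (vseq \<nu> S) \<and>
      DSRP_condition \<kappa> \<S> T \<delta> \<nu> Q S \<and> \<alpha> \<in> elts (vsucc \<delta>) \<and> \<alpha> \<in> elts \<nu> \<and>
      fun_closure F (stage \<alpha> Q S) \<inter> H \<kappa> \<subseteq> (\<Union>\<beta>\<in>elts (vsucc \<delta>). elts (Q \<beta>)) \<and>
      fun_closure F (stage \<alpha> Q S) \<inter> \<S> \<subseteq> S ` elts \<nu>"
      unfolding closing_conditions_def mem_Collect_eq by (elim exE) (rule that)
    then have "?good \<alpha> \<delta> \<nu> Q S" using p(1) by simp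
    then show "\<exists>\<delta> \<nu> Q S. ?good \<alpha> \<delta> \<nu> Q S" by (intro exI)
  qed
  from this[unfolded bchoice_iff] obtain d n q s
    where good: "\<forall>\<alpha>\<in>elts omega1. ?good \<alpha> (d \<alpha>) (n \<alpha>) (q \<alpha>) (s \<alpha>)"
    by (elim exE) (rule that)
  have mem: "vpair (vseq (vsucc (d \<alpha>)) (q \<alpha>)) (vseq (n \<alpha>) (s \<alpha>)) \<in> G"
    and cond: "DSRP_condition \<kappa> \<S> T (d \<alpha>) (n \<alpha>) (q \<alpha>) (s \<alpha>)"
    and d: "\<alpha> \<in> elts (vsucc (d \<alpha>))" and n: "\<alpha> \<in> elts (n \<alpha>)"
    and close1: "fun_closure F (stage \<alpha> (q \<alpha>) (s \<alpha>)) \<inter> H \<kappa> \<subseteq> (\<Union>\<beta>\<in>elts (vsucc (d \<alpha>)). elts (q \<alpha> \<beta>))"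
    and close2: "fun_closure F (stage \<alpha> (q \<alpha>) (s \<alpha>)) \<inter> \<S> \<subseteq> s \<alpha> ` elts (n \<alpha>)"
    if "\<alpha> \<in> elts omega1" for \<alpha>
    using bspec[OF good that] by (simp_all only:)
  have d\<omega>: "d \<alpha> \<in> elts omega1" and n\<omega>: "n \<alpha> \<in> elts omega1"
    and chain: "continuous_chain \<kappa> (vsucc (d \<alpha>)) (q \<alpha>)"
    and lab: "\<And>i. i \<in> elts (n \<alpha>) \<Longrightarrow> s \<alpha> i \<in> \<S>" 
    and diag: "\<And>\<beta> i. \<beta> \<in> elts (vsucc (d \<alpha>)) \<Longrightarrow> i \<in> elts omega1 \<Longrightarrow> \<beta> \<in> T i \<Longrightarrow>
      i \<in> elts (n \<alpha>) \<and> q \<alpha> \<beta> \<in> elts (s \<alpha> i)"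
    if "\<alpha> \<in> elts omega1" for \<alpha>
    using cond[OF that] unfolding DSRP_condition_def by blast+
  \<comment> \<open>Position \<open>\<alpha>\<close> is read off the condition chosen for \<open>\<alpha>\<close>; by agreement any other choice gives the same.\<close>
  define Q where "Q \<alpha> = q \<alpha> \<alpha>" for \<alpha>
  define S where "S \<alpha> = s \<alpha> \<alpha>" for \<alpha>
  have d_sub: "elts (vsucc (d \<alpha>)) \<subseteq> elts omega1" if "\<alpha> \<in> elts omega1" for \<alpha>
    using omega1_trans[OF omega1_vsucc[OF d\<omega>[OF that]]] by blast
  have n_sub: "elts (n \<alpha>) \<subseteq> elts omega1" if "\<alpha> \<in> elts omega1" for \<alpha>
    using omega1_trans[OF n\<omega>[OF that]] by blast
  have Q: "q \<alpha> \<beta> = Q \<beta>" if "\<alpha> \<in> elts omega1" "\<beta> \<in> elts (vsucc (d \<alpha>))" for \<alpha> \<beta>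
    unfolding Q_def
    by (rule filter_conditions_agree(1)[OF G mem mem]) (use that d_sub d in blast)+
  have S: "s \<alpha> i = S i" if "\<alpha> \<in> elts omega1" "i \<in> elts (n \<alpha>)" for \<alpha> i
    unfolding S_def
    by (rule filter_conditions_agree(2)[OF G mem mem]) (use that n_sub n in blast)+
  have below_d: "elts (vsucc \<alpha>) \<subseteq> elts (vsucc (d \<alpha>))" if \<alpha>: "\<alpha> \<in> elts omega1" for \<alpha>
    using d[OF \<alpha>] Ord_trans[OF omega1_Ord[OF omega1_vsucc[OF d\<omega>[OF \<alpha>]]] d[OF \<alpha>]] by auto
  have below_n: "elts (vsucc \<alpha>) \<subseteq> elts (n \<alpha>)" if \<alpha>: "\<alpha> \<in> elts omega1" for \<alpha>
    using n[OF \<alpha>] Ord_trans[OF omega1_Ord[OF n\<omega>[OF \<alpha>]] n[OF \<alpha>]] by auto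
  have chain_Q: "continuous_chain \<kappa> (vsucc (d \<alpha>)) Q" if \<alpha>: "\<alpha> \<in> elts omega1" for \<alpha>
    by (rule continuous_chain_cong[OF omega1_Ord[OF omega1_vsucc[OF d\<omega>[OF \<alpha>]]] Q[OF \<alpha>] chain[OF \<alpha>]])
  have stage: "stage \<alpha> (q \<alpha>) (s \<alpha>) = stage \<alpha> Q S" if \<alpha>: "\<alpha> \<in> elts omega1" for \<alpha>
    using Q[OF \<alpha>] S[OF \<alpha>] below_d[OF \<alpha>] below_n[OF \<alpha>]
    by (intro stage_cong[OF omega1_Ord[OF \<alpha>]]) blast+
  have cl_H: "fun_closure F (stage \<alpha> Q S) \<inter> H \<kappa> \<subseteq> (\<Union>\<beta>\<in>elts omega1. elts (Q \<beta>))"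
    if \<alpha>: "\<alpha> \<in> elts omega1" for \<alpha>
  proof -
    have "(\<Union>\<beta>\<in>elts (vsucc (d \<alpha>)). elts (q \<alpha> \<beta>)) = (\<Union>\<beta>\<in>elts (vsucc (d \<alpha>)). elts (Q \<beta>))"
      using Q[OF \<alpha>] by (intro SUP_cong refl) simp
    also have "\<dots> \<subseteq> (\<Union>\<beta>\<in>elts omega1. elts (Q \<beta>))" using d_sub[OF \<alpha>] by (rule UN_mono) simp
    finally show ?thesis using close1[OF \<alpha>] unfolding stage[OF \<alpha>] by (rule subset_trans[rotated])
  qed
  have cl_S: "fun_closure F (stage \<alpha> Q S) \<inter> \<S> \<subseteq> S ` elts omega1" if \<alpha>: "\<alpha> \<in> elts omega1" for \<alpha>
  proof -
    have "s \<alpha> ` elts (n \<alpha>) = S ` elts (n \<alpha>)" using S[OF \<alpha>] by (rule image_cong[OF refl])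
    also have "\<dots> \<subseteq> S ` elts omega1" using n_sub[OF \<alpha>] by (rule image_mono)
    finally show ?thesis using close2[OF \<alpha>] unfolding stage[OF \<alpha>] by (rule subset_trans[rotated])
  qed
  have S_mem: "S i \<in> \<S>" if "i \<in> elts omega1" for i
    using lab[OF that n[OF that]] unfolding S_def .
  have Q_props: "elts (Q \<alpha>) \<subseteq> H \<kappa> \<and> countable (elts (Q \<alpha>))" if \<alpha>: "\<alpha> \<in> elts omega1" for \<alpha>
    using chain_Q[OF \<alpha>] d[OF \<alpha>] unfolding continuous_chain_def by blast
  have Q_H: "Q \<alpha> \<in> H \<kappa>" if "\<alpha> \<in> elts omega1" for \<alpha>
    using countable_elts_in_H[OF \<kappa>] Q_props[OF that] by simp
  have Q_chain: "continuous_chain \<kappa> omega1 Q" unfolding continuous_chain_def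
  proof (intro conjI ballI impI)
    fix \<alpha> :: 'v assume \<alpha>: "\<alpha> \<in> elts omega1"
    show "elts (Q \<alpha>) \<subseteq> H \<kappa>" "countable (elts (Q \<alpha>))" using Q_props[OF \<alpha>] by auto
    show "elts (Q \<alpha>) = (\<Union>\<beta>\<in>elts \<alpha>. elts (Q \<beta>))" if "Limit \<alpha>"
      using chain_Q[OF \<alpha>] d[OF \<alpha>] that unfolding continuous_chain_def by blast
    assume \<alpha>': "vsucc \<alpha> \<in> elts omega1"
    have "\<alpha> \<in> elts (vsucc (d (vsucc \<alpha>)))" using below_d[OF \<alpha>'] by auto
    then show "Q \<alpha> \<in> elts (Q (vsucc \<alpha>))"
      using chain_Q[OF \<alpha>'] d[OF \<alpha>'] unfolding continuous_chain_def by blast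
  qed
  have code_H: "vseq \<alpha> Q \<in> H \<kappa>" if \<alpha>: "\<alpha> \<in> elts omega1" for \<alpha>
  proof (rule vseq_in_H[OF \<kappa> omega1_countable[OF \<alpha>]])
    show "elts \<alpha> \<subseteq> H \<kappa>" using omega1_trans[OF \<alpha>] omega1_subset_H[OF \<kappa>] by blast
    show "Q ` elts \<alpha> \<subseteq> H \<kappa>" using omega1_trans[OF \<alpha>] Q_H by blast
  qed
  define X where "X = (\<Union>\<alpha>\<in>elts omega1. fun_closure F (stage \<alpha> Q S))"
  have stage_X: "stage \<alpha> Q S \<subseteq> X" if "\<alpha> \<in> elts omega1" for \<alpha>
    using that subset_fun_closure[of "stage \<alpha> Q S" F] unfolding X_def by blast
  have "\<alpha> \<in> X \<and> elts (Q \<alpha>) \<subseteq> X \<and> S \<alpha> \<in> X \<and> vseq \<alpha> Q \<in> X" if "\<alpha> \<in> elts omega1" for \<alpha>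
    using stage_X[OF that] unfolding stage_def by auto
  then have \<omega>_X: "elts omega1 \<subseteq> X" and Q_X: "(\<Union>\<alpha>\<in>elts omega1. elts (Q \<alpha>)) \<subseteq> X"
    and S_X: "S ` elts omega1 \<subseteq> X" and code_X: "(\<lambda>\<alpha>. vseq \<alpha> Q) ` elts omega1 \<subseteq> X"
    by blast+
  have H_sub: "H \<kappa> \<subseteq> H \<theta>" using \<theta> by (rule H_subset_H)
  have stage_H: "stage \<alpha> Q S \<subseteq> H \<theta>" if \<alpha>: "\<alpha> \<in> elts omega1" for \<alpha>
  proof -
    have *: "\<beta> \<in> elts omega1" if "\<beta> \<in> elts (vsucc \<alpha>)" for \<beta> using omega1_trans[OF omega1_vsucc[OF \<alpha>] that] .
    have "elts (vsucc \<alpha>) \<subseteq> H \<theta>" using * omega1_subset_H[OF \<kappa>] H_sub by blast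
    moreover have "(\<Union>\<beta>\<in>elts (vsucc \<alpha>). elts (Q \<beta>)) \<subseteq> H \<theta>" using * Q_props H_sub by blast
    moreover have "S ` elts (vsucc \<alpha>) \<subseteq> H \<theta>"
    proof (rule image_subsetI)
      fix i assume "i \<in> elts (vsucc \<alpha>)"
      then have "stationary_countable \<kappa> (S i)" using * S_mem stat by blast
      then show "S i \<in> H \<theta>" by (rule stationary_countable_in_H[OF \<kappa> \<theta>])
    qed
    moreover have "(\<lambda>\<beta>. vseq \<beta> Q) ` elts (vsucc \<alpha>) \<subseteq> H \<theta>" using * code_H H_sub by blast
    ultimately show ?thesis unfolding stage_def by (simp only: Un_least)
  qed
  have X_H: "X \<subseteq> H \<theta>" unfolding X_def 
    by (intro UN_least fun_closure_least stage_H mp[OF spec[OF F]] conjI)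
  have mono: "stage \<alpha> Q S \<subseteq> stage \<beta> Q S" if "elts (vsucc \<alpha>) \<subseteq> elts (vsucc \<beta>)" for \<alpha> \<beta>
    using that unfolding stage_def by blast
  have directed: "\<exists>\<alpha>\<in>elts omega1. e \<subseteq> fun_closure F (stage \<alpha> Q S)" if "finite e" "e \<subseteq> X" for e
    using that
  proof (induction e)
    case empty
    have "elts (omega1 :: 'v) \<noteq> {}" using uncountable_omega1 by (metis countable_empty)
    then show ?case by blast
  next
    case (insert y e)
    then obtain \<alpha> \<beta> where \<alpha>: "\<alpha> \<in> elts omega1" "y \<in> fun_closure F (stage \<alpha> Q S)"
      and \<beta>: "\<beta> \<in> elts omega1" "e \<subseteq> fun_closure F (stage \<beta> Q S)" unfolding X_def by auto
    have "countable {\<alpha>, \<beta>}" "{\<alpha>, \<beta>} \<subseteq> elts omega1" using \<alpha>(1) \<beta>(1) by auto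
    from countable_bounded_omega1[OF this]
    obtain \<gamma> where \<gamma>: "\<gamma> \<in> elts omega1" "{\<alpha>, \<beta>} \<subseteq> elts \<gamma>" by (rule bexE)
    have "elts (vsucc \<alpha>) \<subseteq> elts (vsucc \<gamma>)" "elts (vsucc \<beta>) \<subseteq> elts (vsucc \<gamma>)"
      using \<gamma>(2) Ord_trans[OF omega1_Ord[OF \<gamma>(1)]] by auto
    then have "fun_closure F (stage \<alpha> Q S) \<subseteq> fun_closure F (stage \<gamma> Q S)"
      "fun_closure F (stage \<beta> Q S) \<subseteq> fun_closure F (stage \<gamma> Q S)"
      by (auto intro!: fun_closure_mono mono simp del: elts_vsucc)
    then have "insert y e \<subseteq> fun_closure F (stage \<gamma> Q S)" using \<alpha>(2) \<beta>(2) by blast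
    then show ?case using \<gamma>(1) by blast
  qed
  have X_closed: "F e \<in> X" if e: "finite e" "e \<subseteq> X" for e
  proof -
    from directed[OF e] obtain \<alpha>
      where \<alpha>: "\<alpha> \<in> elts omega1" "e \<subseteq> fun_closure F (stage \<alpha> Q S)" by (rule bexE)
    have "F e \<in> fun_closure F (stage \<alpha> Q S)" using e(1) \<alpha>(2) by (rule fun_closure_closed)
    then show ?thesis using \<alpha>(1) unfolding X_def by blast
  qed
  have inf: "infinite (elts (omega1 :: 'v))" by (rule uncountable_infinite[OF uncountable_omega1])
  have "X \<lesssim> elts (omega1 :: 'v)" unfolding X_def
  proof (rule UN_lepoll[OF inf lepoll_refl])
    fix \<alpha> :: 'v assume \<alpha>: "\<alpha> \<in> elts omega1"
    have ct: "countable (elts (vsucc \<alpha>))" by (rule omega1_countable[OF omega1_vsucc[OF \<alpha>]])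
    have "countable (elts (Q \<beta>))" if "\<beta> \<in> elts (vsucc \<alpha>)" for \<beta>
      using Q_props[OF omega1_trans[OF omega1_vsucc[OF \<alpha>] that]] by blast
    then have "countable (stage \<alpha> Q S)"
      unfolding stage_def using ct by (intro countable_Un countable_UN countable_image)
    then have "countable (fun_closure F (stage \<alpha> Q S))" by (rule countable_fun_closure)
    then have "fun_closure F (stage \<alpha> Q S) \<lesssim> (UNIV :: nat set)"
      unfolding countable_def lepoll_def by blast
    also have "\<dots> \<lesssim> elts (omega1 :: 'v)" using inf unfolding infinite_le_lepoll .
    finally show "fun_closure F (stage \<alpha> Q S) \<lesssim> elts (omega1 :: 'v)" .
  qed
  then have "X \<approx> elts (omega1 :: 'v)" using subset_imp_lepoll[OF \<omega>_X] by (rule lepoll_antisym)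
  moreover have "diagonal_chain \<kappa> \<S> T X Q S" unfolding diagonal_chain_def
  proof (intro conjI ballI impI)
    show "continuous_chain \<kappa> omega1 Q" by (rule Q_chain)
    show "S j \<in> \<S>" if "j \<in> elts omega1" for j by (rule S_mem[OF that])
    show "Q i \<in> elts (S j)" if i: "i \<in> elts omega1" and j: "j \<in> elts omega1" "i \<in> T j" for i j
      using diag[OF i d[OF i] j] S[OF i] unfolding Q_def by auto
    show "H \<kappa> \<inter> X = (\<Union>\<alpha>\<in>elts omega1. elts (Q \<alpha>))"
    proof
      show "H \<kappa> \<inter> X \<subseteq> (\<Union>\<alpha>\<in>elts omega1. elts (Q \<alpha>))" using cl_H unfolding X_def by blast
      show "(\<Union>\<alpha>\<in>elts omega1. elts (Q \<alpha>)) \<subseteq> H \<kappa> \<inter> X" using Q_X Q_props by blast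
    qed
    show "vseq \<alpha> Q \<in> H \<kappa> \<inter> X" if "\<alpha> \<in> elts omega1" for \<alpha> using code_H[OF that] code_X that by blast
    show "\<S> \<inter> X = S ` elts omega1"
    proof
      show "\<S> \<inter> X \<subseteq> S ` elts omega1" using cl_S unfolding X_def by blast
      show "S ` elts omega1 \<subseteq> \<S> \<inter> X" using S_X S_mem by blast
    qed
  qed
  ultimately show ?thesis using X_H \<omega>_X X_closed by blast
qed

theorem lemma3p11:
  fixes \<Gamma> :: "'v::zfc_universe forcing set"
  assumes "forcing_class \<Gamma>"
    and "FA \<Gamma>"
  shows "class_DSRP \<Gamma>"
  unfolding class_DSRP_def class_DSRP_at_def DSRP_def stationary_in_def
proof (intro allI impI conjI ballI)
  fix \<kappa> :: 'v and \<S> T \<theta> X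
  assume "X \<in> {X. X \<subseteq> H \<theta> \<and> X \<approx> elts (omega1 :: 'v) \<and> elts omega1 \<subseteq> X \<and>
    (\<exists>Q S. diagonal_chain \<kappa> \<S> T X Q S)}"
  then show "X \<subseteq> H \<theta>" by blast
next
  fix \<kappa> \<theta> :: 'v and \<S> :: "'v set" and T :: "'v \<Rightarrow> 'v set" and F :: "'v set \<Rightarrow> 'v"
  assume \<kappa>: "regular \<kappa> \<and> omega1 \<in> elts \<kappa>"
    and hyp: "\<S> \<noteq> {} \<and> (\<forall>S\<in>\<S>. stationary_countable \<kappa> S) \<and>
      (\<forall>i\<in>elts omega1. stationary_omega1 (T i)) \<and> disjoint_family_on T (elts omega1) \<and>
      projective_stationary \<Gamma> \<kappa> \<S> T"
    and \<theta>: "regular \<theta> \<and> weak_power \<kappa> \<in> elts \<theta>"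
    and F: "\<forall>x. finite x \<and> x \<subseteq> H \<theta> \<longrightarrow> F x \<in> H \<theta>"
  have \<kappa>': "uncountable_regular \<kappa>" using \<kappa> unfolding uncountable_regular_def .
  have ne: "\<S> \<noteq> {}" and stat: "\<forall>S\<in>\<S>. stationary_countable \<kappa> S"
    and T: "disjoint_family_on T (elts omega1)" and P: "DSRP_forcing \<kappa> \<S> T \<in> \<Gamma>"
    using hyp unfolding projective_stationary_def by blast+
  have "\<forall>\<alpha>\<in>elts omega1. dense_in (DSRP_forcing \<kappa> \<S> T) (closing_conditions \<kappa> \<S> T F \<alpha>)"
    using dense_closing_conditions[OF \<kappa>' stat T ne] by blast
  from mp[OF spec[OF bspec[OF assms(2)[unfolded FA_def] P]] this]
  obtain G where G: "filter_on (DSRP_forcing \<kappa> \<S> T) G"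
    "\<forall>\<alpha>\<in>elts omega1. G \<inter> closing_conditions \<kappa> \<S> T F \<alpha> \<noteq> {}"
    by (elim exE conjE) (rule that)
  have "H \<kappa> \<prec> elts \<theta>" using H_lesspoll[OF \<kappa>'] \<theta> by blast
  from diagonal_chain_of_filter[OF \<kappa>' this stat F G] obtain X Q S where
    "X \<subseteq> H \<theta>" "X \<approx> elts (omega1 :: 'v)" "elts omega1 \<subseteq> X" "diagonal_chain \<kappa> \<S> T X Q S"
    "\<forall>x. finite x \<and> x \<subseteq> X \<longrightarrow> F x \<in> X" by (elim exE conjE) (rule that)
  then show "\<exists>X\<in>{X. X \<subseteq> H \<theta> \<and> X \<approx> elts (omega1 :: 'v) \<and> elts omega1 \<subseteq> X \<and>
      (\<exists>Q S. diagonal_chain \<kappa> \<S> T X Q S)}. \<forall>x. finite x \<and> x \<subseteq> X \<longrightarrow> F x \<in> X"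
    by blast
qed

end
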